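(* Let $G$ be a binary game structure of height $k$, let $\varepsilon=\frac{1}{R\,2^{k}}$ with $R\ge 4$ an even integer (high resolution), and let $\gamma=BE(G,\varepsilon)$ be the Bottom Equilibrium of the bidding game $\langle G,\varepsilon\rangle$. Then: (A) for every $s\in S\setminus T$ and every $B_1\in\mathcal B_\varepsilon$, the bids $(b_1,b_2)$ in $\gamma(s,B_1)$ satisfy either $b_1=b_2$ (if player 1 wins) or $b_2=b_1+\varepsilon$ (if player 2 wins); (B) $\gamma$ is an interval profile; (C) $\gamma$ is Pareto-surjective; (D) $\gamma$ is Pareto-optimal; (E) $\gamma$ is monotone.
   Context: A (two-player, impartial) game structure is $G=\langle S,s_0,T,g,u_1,u_2\rangle$ with a finite set of states $S$, initial state $s_0\in S$, terminals $T\subseteq S$ (also written $T(G)$), a move function $g$ assigning to each $s\in S\setminus T$ a nonempty set $g(s)\subseteq S$ of next states available to both players (no directed cycles), and utilities $u_i:T\to\mathbb R$. $G$ is binary if $|g(s)|\le 2$ for all $s\in S\setminus T$. The height of a state is the maximal length of a path from it to a terminal; the height of $G$ is the height of $s_0$. Preferences: $t\succ_i t'$ iff $u_i(t)>u_i(t')$, or $u_i(t)=u_i(t')$ and $u_{-i}(t)>u_{-i}(t')$, where $-i$ is the other player. Terminals with the same pair of utilities are regarded as the same outcome, so each $\succ_i$ is a strict linear order on outcomes; $\succeq_i$ is its weak version. Bidding game $\langle G,\varepsilon\rangle$: budgets and bids are in $\mathcal B_\varepsilon=\{0,\varepsilon,\dots,1\}$; a budget partition $(B_1,B_2)$, $B_1+B_2=1$,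 is identified with $B_1$. At $s\in S\setminus T$ with budgets $(B_1,B_2)$ each player $i$ simultaneously submits a bid $b_i\le B_i$ and a next state $s_i^*\in g(s)$. The higher bidder wins (ties won by player 1, "white"; player 2 is "black"), pays her bid to the other player, and the game moves to the winner's selected state with the updated budgets. A strategy profile $\gamma$ specifies bids and next states for all $s\in S\setminus T$ and $B_1\in\mathcal B_\varepsilon$. $\mu_\gamma(s,B_1)\in T$ is the terminal reached when $\gamma$ is played from $(s,B_1)$, and $\mu_\gamma(B_1)=\mu_\gamma(s_0,B_1)$. $\gamma$ is a PSPE if for every $(s,B_1)$ each player best-responds to the other (with respect to $\succ_i$ on the terminal reached) in the subgame from $(s,B_1)$. Order $\pi$ on profiles (compares only bids; equilibria with the same bids everywhere are identified). (1) For fixed $(s,B_1)$ with bids $(b_1,b_2)$ in $\gamma$ and $(b_1',b_2')$ in $\gamma'$: $\gamma'(s,B_1)>_\pi\gamma(s,B_1)$ if (i) $\max\{b_1',b_2'\}>\max\{b_1,b_2\}$; or (ii) the winning (higher) bids are equal and the losing bid in $\gamma'$ is lower; or (iii) $b_1'=b_2>b_1=b_2'$. (2) $\gamma'_s>_\pi\gamma_s$ if $\gamma'(s,B_1)\ge_\pi\gamma(s,B_1)$ for all $B_1\in\mathcal B_\varepsilon$ with at least one strict inequality. (3) Recursively, $\gamma'=_{\sigma(t)}\gamma$ for $t\in T$; for $s\in S\setminus T$, $\gamma'>_{\sigma(s)}\gamma$ if $\gamma'\ge_{\sigma(s')}\gamma$ for all $s'\in g(s)$ and either $\gamma'>_{\sigma(s')}\gamma$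 for some $s'\in g(s)$ or $\gamma'_s>_\pi\gamma_s$. (4) $\gamma'>_\pi\gamma$ if $\gamma'>_{\sigma(s_0)}\gamma$. The Bottom Equilibrium $BE(G,\varepsilon)$ is the unique minimum of $\pi$ on the set of PSPEs of $\langle G,\varepsilon\rangle$ (it exists, since the set of PSPEs is finite, nonempty and a meet-semilattice under $\pi$). Properties of a profile $\gamma$: - Interval profile: for $j=0,\dots,2^k-1$ let $B_1^j=j/2^k$ and $\mathcal B^j=\{B_1\in\mathcal B_\varepsilon: B_1^j\le B_1<B_1^{j+1}\}$, with $B_1=1$ included in the last one $\mathcal B^{2^k-1}$. $\gamma$ is an interval profile if $\mu_\gamma(s,\hat B_1)=\mu_\gamma(s,B_1^j)$ for all $s\in S\setminus T$, all $j<2^k$ and all $\hat B_1\in\mathcal B^j$. - $T_P(G)$ is the set of Pareto-efficient terminals: $t\in T_P(G)$ iff there is no $t'\in T$ with $t'\succ_1 t$ and $t'\succ_2 t$. - Pareto-surjective: for every $t\in T_P(G)$ there is $B_1\in\mathcal B_\varepsilon$ with $\mu_\gamma(B_1)=t$. - Pareto-optimal: $\mu_\gamma(B_1)\in T_P(G)$ for all $B_1\in\mathcal B_\varepsilon$. - Monotone: $\mu_\gamma(B_1')\succeq_1\mu_\gamma(B_1)$ whenever $B_1'>B_1$, and likewise for player 2 (her outcome weakly improves in $\succeq_2$ as $B_2$ increases).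
   Formalization: Every state of G is assumed reachable from the initial state; otherwise an unreachable terminal that dominates the reachable ones makes (C) and (D) false, and the Bottom Equilibrium is not determined at unreachable states. *)

theory Defs
  imports Complex_Main
begin

section \<open>Game structures\<close>

datatype player = P1 | P2

fun other :: "player \<Rightarrow> player" where
  "other P1 = P2"
| "other P2 = P1"

record 's game =
  states :: "'s set"
  init :: 's
  terminals :: "'s set"
  moves :: "'s \<Rightarrow> 's set"
  util :: "player \<Rightarrow> 's \<Rightarrow> real"

definition nonterminals :: "'s game \<Rightarrow> 's set" where
  "nonterminals G = states G - terminals G"

definition edges :: "'s game \<Rightarrow> ('s \<times> 's) set" where
  "edges G = {(s, s'). s \<in> nonterminals G \<and> s' \<in> moves G s}"

text \<open>
  The last conjunct says that every state is a position of the game. States that cannot be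
  reached from the initial state play no role in the height of the game or in the order on
  profiles that selects the Bottom Equilibrium, while they would count in the set of terminals
  that defines Pareto efficiency.
\<close>

definition game_structure :: "'s game \<Rightarrow> bool" where
  "game_structure G \<longleftrightarrow>
     finite (states G) \<and>
     init G \<in> states G \<and>
     terminals G \<subseteq> states G \<and>
     (\<forall>s\<in>nonterminals G. moves G s \<noteq> {} \<and> moves G s \<subseteq> states G) \<and>
     acyclic (edges G) \<and>
     (\<forall>s\<in>states G. (init G, s) \<in> (edges G)\<^sup>*)"

definition binary :: "'s game \<Rightarrow> bool" where
  "binary G \<longleftrightarrow> (\<forall>s\<in>nonterminals G. card (moves G s) \<le> 2)"

definition state_height :: "'s game \<Rightarrow> 's \<Rightarrow> nat" where
  "state_height G s = Max {n. \<exists>t\<in>terminals G. (s, t) \<in> edges G ^^ n}"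

definition height :: "'s game \<Rightarrow> nat" where
  "height G = state_height G (init G)"

section \<open>Preferences\<close>

definition prefers :: "'s game \<Rightarrow> player \<Rightarrow> 's \<Rightarrow> 's \<Rightarrow> bool" where
  "prefers G i t t' \<longleftrightarrow>
     util G i t > util G i t' \<or>
     (util G i t = util G i t' \<and> util G (other i) t > util G (other i) t')"

text \<open>
  Terminals with the same pair of utilities are the same outcome; equality of outcomes is
  always meant in this sense.
\<close>

definition same_outcome :: "'s game \<Rightarrow> 's \<Rightarrow> 's \<Rightarrow> bool" where
  "same_outcome G t t' \<longleftrightarrow> (\<forall>i. util G i t = util G i t')"

definition weakly_prefers :: "'s game \<Rightarrow> player \<Rightarrow> 's \<Rightarrow> 's \<Rightarrow> bool" where
  "weakly_prefers G i t t' \<longleftrightarrow> prefers G i t t' \<or> same_outcome G t t'"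

definition pareto_terminals :: "'s game \<Rightarrow> 's set" where
  "pareto_terminals G =
     {t \<in> terminals G. \<not> (\<exists>t'\<in>terminals G. prefers G P1 t' t \<and> prefers G P2 t' t)}"

section \<open>Bidding games\<close>

definition budgets :: "real \<Rightarrow> real set" where
  "budgets \<epsilon> = {x. \<exists>n::nat. x = real n * \<epsilon> \<and> x \<le> 1}"

text \<open>A budget partition is represented by the budget of player 1.\<close>

fun budget_of :: "player \<Rightarrow> real \<Rightarrow> real" where
  "budget_of P1 B = B"
| "budget_of P2 B = 1 - B"

text \<open>
  A strategy maps a state and a budget partition to a bid and a next state. Its values outside
  the nonterminal states and the budgets on the grid are irrelevant.
\<close>

type_synonym 's strategy = "'s \<Rightarrow> real \<Rightarrow> real \<times> 's"
type_synonym 's profile = "player \<Rightarrow> 's strategy"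

definition bid :: "'s profile \<Rightarrow> player \<Rightarrow> 's \<Rightarrow> real \<Rightarrow> real" where
  "bid \<gamma> i s B = fst (\<gamma> i s B)"

definition choice :: "'s profile \<Rightarrow> player \<Rightarrow> 's \<Rightarrow> real \<Rightarrow> 's" where
  "choice \<gamma> i s B = snd (\<gamma> i s B)"

definition legal_strategy :: "'s game \<Rightarrow> real \<Rightarrow> player \<Rightarrow> 's strategy \<Rightarrow> bool" where
  "legal_strategy G \<epsilon> i \<sigma> \<longleftrightarrow>
     (\<forall>s\<in>nonterminals G. \<forall>B\<in>budgets \<epsilon>.
        fst (\<sigma> s B) \<in> budgets \<epsilon> \<and> fst (\<sigma> s B) \<le> budget_of i B \<and> snd (\<sigma> s B) \<in> moves G s)"

definition wins :: "'s profile \<Rightarrow> player \<Rightarrow> 's \<Rightarrow> real \<Rightarrow> bool" where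
  "wins \<gamma> i s B \<longleftrightarrow>
     (case i of P1 \<Rightarrow> bid \<gamma> P2 s B \<le> bid \<gamma> P1 s B | P2 \<Rightarrow> bid \<gamma> P1 s B < bid \<gamma> P2 s B)"

text \<open>One round of play; the play stays put at terminals.\<close>

fun step :: "'s game \<Rightarrow> 's profile \<Rightarrow> 's \<times> real \<Rightarrow> 's \<times> real" where
  "step G \<gamma> (s, B) =
     (if s \<in> terminals G then (s, B)
      else if wins \<gamma> P1 s B then (choice \<gamma> P1 s B, B - bid \<gamma> P1 s B)
      else (choice \<gamma> P2 s B, B + bid \<gamma> P2 s B))"

text \<open>The terminal reached when the profile is played from the given state and budgets.\<close>

definition outcome :: "'s game \<Rightarrow> 's profile \<Rightarrow> 's \<Rightarrow> real \<Rightarrow> 's" where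
  "outcome G \<gamma> s B = (THE t. t \<in> terminals G \<and> (\<exists>n. fst ((step G \<gamma> ^^ n) (s, B)) = t))"

text \<open>Pure subgame perfect equilibrium.\<close>

definition PSPE :: "'s game \<Rightarrow> real \<Rightarrow> 's profile \<Rightarrow> bool" where
  "PSPE G \<epsilon> \<gamma> \<longleftrightarrow>
     (\<forall>i. legal_strategy G \<epsilon> i (\<gamma> i)) \<and>
     (\<forall>s\<in>states G. \<forall>B\<in>budgets \<epsilon>. \<forall>i \<sigma>. legal_strategy G \<epsilon> i \<sigma> \<longrightarrow>
        weakly_prefers G i (outcome G \<gamma> s B) (outcome G (\<gamma>(i := \<sigma>)) s B))"

section \<open>The order on profiles and the Bottom Equilibrium\<close>

definition bids :: "'s profile \<Rightarrow> 's \<Rightarrow> real \<Rightarrow> real \<times> real" where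
  "bids \<gamma> s B = (bid \<gamma> P1 s B, bid \<gamma> P2 s B)"

fun bids_gt :: "real \<times> real \<Rightarrow> real \<times> real \<Rightarrow> bool" where
  "bids_gt (b1', b2') (b1, b2) \<longleftrightarrow>
     max b1' b2' > max b1 b2 \<or>
     (max b1' b2' = max b1 b2 \<and> min b1' b2' < min b1 b2) \<or>
     (b1' = b2 \<and> b2 > b1 \<and> b1 = b2')"

definition state_gt :: "real \<Rightarrow> 's profile \<Rightarrow> 's profile \<Rightarrow> 's \<Rightarrow> bool" where
  "state_gt \<epsilon> \<gamma>' \<gamma> s \<longleftrightarrow>
     (\<forall>B\<in>budgets \<epsilon>. bids_gt (bids \<gamma>' s B) (bids \<gamma> s B) \<or> bids \<gamma>' s B = bids \<gamma> s B) \<and>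
     (\<exists>B\<in>budgets \<epsilon>. bids_gt (bids \<gamma>' s B) (bids \<gamma> s B))"

text \<open>
  Profiles with the same bids everywhere are identified, so equality of two profiles in the
  subgame of \<open>s\<close> means equal bids at all its nonterminal states. At a terminal it always holds.
\<close>

definition subgame_eq :: "'s game \<Rightarrow> real \<Rightarrow> 's profile \<Rightarrow> 's profile \<Rightarrow> 's \<Rightarrow> bool" where
  "subgame_eq G \<epsilon> \<gamma>' \<gamma> s \<longleftrightarrow>
     (\<forall>s'\<in>nonterminals G. (s, s') \<in> (edges G)\<^sup>* \<longrightarrow>
        (\<forall>B\<in>budgets \<epsilon>. bids \<gamma>' s' B = bids \<gamma> s' B))"

text \<open>
  The recursion along the edges is well-founded for a finite acyclic game, so the least fixed
  point taken here is the only one.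
\<close>

inductive subgame_gt :: "'s game \<Rightarrow> real \<Rightarrow> 's profile \<Rightarrow> 's profile \<Rightarrow> 's \<Rightarrow> bool"
  for G :: "'s game" and \<epsilon> :: real and \<gamma>' \<gamma> :: "'s profile" where
  "\<lbrakk> s \<in> nonterminals G;
     \<forall>s'\<in>moves G s. subgame_gt G \<epsilon> \<gamma>' \<gamma> s' \<or> subgame_eq G \<epsilon> \<gamma>' \<gamma> s';
     (\<exists>s'\<in>moves G s. subgame_gt G \<epsilon> \<gamma>' \<gamma> s') \<or> state_gt \<epsilon> \<gamma>' \<gamma> s \<rbrakk>
   \<Longrightarrow> subgame_gt G \<epsilon> \<gamma>' \<gamma> s"

definition profile_ge :: "'s game \<Rightarrow> real \<Rightarrow> 's profile \<Rightarrow> 's profile \<Rightarrow> bool" where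
  "profile_ge G \<epsilon> \<gamma>' \<gamma> \<longleftrightarrow>
     subgame_gt G \<epsilon> \<gamma>' \<gamma> (init G) \<or> subgame_eq G \<epsilon> \<gamma>' \<gamma> (init G)"

text \<open>
  The Bottom Equilibrium is unique only up to the identification of profiles with equal bids;
  hence a predicate, satisfied by all its representatives.
\<close>

definition bottom_equilibrium :: "'s game \<Rightarrow> real \<Rightarrow> 's profile \<Rightarrow> bool" where
  "bottom_equilibrium G \<epsilon> \<gamma> \<longleftrightarrow>
     PSPE G \<epsilon> \<gamma> \<and> (\<forall>\<gamma>'. PSPE G \<epsilon> \<gamma>' \<longrightarrow> profile_ge G \<epsilon> \<gamma>' \<gamma>)"

section \<open>Properties of profiles\<close>

definition budget_interval :: "real \<Rightarrow> nat \<Rightarrow> nat \<Rightarrow> real set" where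
  "budget_interval \<epsilon> k j =
     {B \<in> budgets \<epsilon>. (real j / 2 ^ k \<le> B \<and> B < real (j + 1) / 2 ^ k) \<or> (j + 1 = 2 ^ k \<and> B = 1)}"

definition interval_profile :: "'s game \<Rightarrow> real \<Rightarrow> nat \<Rightarrow> 's profile \<Rightarrow> bool" where
  "interval_profile G \<epsilon> k \<gamma> \<longleftrightarrow>
     (\<forall>s\<in>nonterminals G. \<forall>j<2 ^ k. \<forall>B\<in>budget_interval \<epsilon> k j.
        same_outcome G (outcome G \<gamma> s B) (outcome G \<gamma> s (real j / 2 ^ k)))"

definition pareto_surjective :: "'s game \<Rightarrow> real \<Rightarrow> 's profile \<Rightarrow> bool" where
  "pareto_surjective G \<epsilon> \<gamma> \<longleftrightarrow>
     (\<forall>t\<in>pareto_terminals G. \<exists>B\<in>budgets \<epsilon>. same_outcome G (outcome G \<gamma> (init G) B) t)"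

definition pareto_optimal :: "'s game \<Rightarrow> real \<Rightarrow> 's profile \<Rightarrow> bool" where
  "pareto_optimal G \<epsilon> \<gamma> \<longleftrightarrow>
     (\<forall>B\<in>budgets \<epsilon>. outcome G \<gamma> (init G) B \<in> pareto_terminals G)"

definition monotone_profile :: "'s game \<Rightarrow> real \<Rightarrow> 's profile \<Rightarrow> bool" where
  "monotone_profile G \<epsilon> \<gamma> \<longleftrightarrow>
     (\<forall>i. \<forall>B\<in>budgets \<epsilon>. \<forall>B'\<in>budgets \<epsilon>. budget_of i B' > budget_of i B \<longrightarrow>
        weakly_prefers G i (outcome G \<gamma> (init G) B') (outcome G \<gamma> (init G) B))"

end

(*
  Budgets are counted in units of epsilon, and an outcome is represented by its rank in the
  preference of player 1; phi maps that rank to the rank in the preference of player 2.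

  Let a and c be the outcomes of the two successors of a state as functions of player 1's budget.
  At budget x the bottom equilibrium is an ascending auction: bids (m,m) and (m,m+1) alternate
  until the player who is losing no longer gains (in her own preference) from overbidding. Stage m
  compares what player 1 gets at x - m with what player 2 gets at x + m, so the auction walks
  through pairs (l,r) with l + r = 2x or 2x + 1. It is a merge of the two monotone staircases a
  and c, and its result is monotone, Pareto efficient, and reaches every efficient outcome;
  it can change only where both l and r cross a step, i.e. on a grid twice as fine as the
  grid of a and c. By induction on the height, these properties hold at every state.

  The auction bids form a subgame perfect equilibrium, and at each state they are the
  lowest bids among all equilibria with the same continuation values. Hence a bottom
  equilibrium has exactly these bids, by induction from the terminals upwards.
*)
theory Submission
  imports Defs
begin

text \<open>The obstacle is that an equilibrium constrains the winner's move but hardly the loser's.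
  At bids \<open>(m, m)\<close> player 2's planned move matters only if player 1 underbids, so a
  move that is bad for both can serve as a threat. Such a threat might support \<open>(m, m)\<close>
  where the auction ends at \<open>(m - 1, m)\<close>, and \<open>(m, m)\<close> is lower in the
  order. It is excluded because the outcome functions of the successors never step at two adjacent
  budgets. The same separation allows a budget to be shifted by one without changing the outcome,
  which repairs the parity when an efficient outcome has to be reached at an odd index, that is, at
  an actual budget. Separation holds since successors have height below \<open>k\<close>, so that
  their grids consist of even budgets. The order sees bids only, yet it pins down outcomes: in an
  equilibrium the winner's move is optimal, so equal bids over equal continuation values give equal
  results. Minimality is used for a single comparison, with the auction profile.\<close>

section \<open>Merging two monotone outcome functions\<close>

text \<open>
  In a live pair both players want to win: player 1, who would move to \<open>a\<close> with budget \<open>l\<close>, and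
  player 2, who would move to \<open>c\<close> leaving player 1 the budget \<open>r\<close>. Live pairs are visited by
  increasing \<open>r - l\<close>, lowering \<open>l\<close> and raising \<open>r\<close> alternately. A left (right) stop is a live pair
  whose successor, obtained by lowering \<open>l\<close> (raising \<open>r\<close>), is not live.
\<close>

definition live :: "(int \<Rightarrow> real) \<Rightarrow> (int \<Rightarrow> int) \<Rightarrow> (int \<Rightarrow> int) \<Rightarrow> int \<Rightarrow> int \<Rightarrow> bool" where
  "live \<phi> a c l r \<longleftrightarrow> l \<le> r \<and> c r < a l \<and> \<phi> (a l) < \<phi> (c r)"

text \<open>The disjuncts are the two ways in which liveness can fail: player 1 no longer gains from
  winning, so player 2's \<open>c r\<close> stands, or she does but player 2 is content to lose, so
  \<open>a (l-1)\<close> is taken.\<close>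

definition left_stop :: "(int \<Rightarrow> real) \<Rightarrow> (int \<Rightarrow> int) \<Rightarrow> (int \<Rightarrow> int) \<Rightarrow> int \<Rightarrow> int \<Rightarrow> int \<Rightarrow> bool" where
  "left_stop \<phi> a c l r z \<longleftrightarrow> live \<phi> a c l r \<and>
     (a (l-1) \<le> c r \<and> z = c r \<or> c r < a (l-1) \<and> \<phi> (c r) \<le> \<phi> (a (l-1)) \<and> z = a (l-1))"

definition right_stop :: "(int \<Rightarrow> real) \<Rightarrow> (int \<Rightarrow> int) \<Rightarrow> (int \<Rightarrow> int) \<Rightarrow> int \<Rightarrow> int \<Rightarrow> int \<Rightarrow> bool" where
  "right_stop \<phi> a c l r z \<longleftrightarrow> live \<phi> a c l r \<and>
     (\<phi> (c (r+1)) \<le> \<phi> (a l) \<and> z = a l \<or> \<phi> (a l) < \<phi> (c (r+1)) \<and> a l \<le> c (r+1) \<and> z = c (r+1))"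

definition agree :: "(int \<Rightarrow> real) \<Rightarrow> (int \<Rightarrow> int) \<Rightarrow> (int \<Rightarrow> int) \<Rightarrow> int \<Rightarrow> int \<Rightarrow> bool" where
  "agree \<phi> a c j z \<longleftrightarrow> c j \<le> a j \<and> \<phi> (c j) \<le> \<phi> (a j) \<and> z = a j"

text \<open>On the walk for \<open>i\<close>, a pair with sum \<open>i\<close> is followed by
  lowering \<open>l\<close>, one with sum \<open>i - 1\<close> by raising \<open>r\<close>. Hence
  each kind of stop is sought on one sum only.\<close>

definition half_result :: "(int \<Rightarrow> real) \<Rightarrow> (int \<Rightarrow> int) \<Rightarrow> (int \<Rightarrow> int) \<Rightarrow> int \<Rightarrow> int \<Rightarrow> bool" where
  "half_result \<phi> a c i z \<longleftrightarrow> agree \<phi> a c (i div 2) z \<or>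
     (\<exists>l r. l + r = i \<and> left_stop \<phi> a c l r z) \<or> (\<exists>l r. l + r = i - 1 \<and> right_stop \<phi> a c l r z)"

text \<open>
  The pairs visited for the index \<open>i\<close> have \<open>l + r\<close> in \<open>{i - 1, i}\<close>. The game at budget \<open>x\<close>
  corresponds to \<open>i = 2 * x + 1\<close>; even indices only serve to go from \<open>x\<close> to \<open>x + 1\<close> in two steps.
\<close>

definition merged :: "(int \<Rightarrow> real) \<Rightarrow> (int \<Rightarrow> int) \<Rightarrow> (int \<Rightarrow> int) \<Rightarrow> int \<Rightarrow> int \<Rightarrow> bool" where
  "merged \<phi> a c i z \<longleftrightarrow> half_result \<phi> a c i z \<or> half_result \<phi> c a i z"

lemma merged_swap: "merged \<phi> c a = merged \<phi> a c"
  by (auto simp: merged_def fun_eq_iff)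

text \<open>
  The arguments \<open>-1\<close> and \<open>N + 1\<close> stand for a bid that player 1, respectively player 2, cannot pay.
  Giving them the worst outcome of that player makes budget limits a special case of stopping.
\<close>

locale two_chains =
  fixes \<phi> :: "int \<Rightarrow> real" and N :: int and a c :: "int \<Rightarrow> int"
  assumes inj: "inj \<phi>" and N: "0 \<le> N"
    and a_mono: "x \<le> y \<Longrightarrow> a x \<le> a y" and a_anti: "x \<le> y \<Longrightarrow> \<phi> (a y) \<le> \<phi> (a x)"
    and c_mono: "x \<le> y \<Longrightarrow> c x \<le> c y" and c_anti: "x \<le> y \<Longrightarrow> \<phi> (c y) \<le> \<phi> (c x)"
    and bot: "a (-1) = c (-1)" "a (-1) < a 0" "c (-1) < c 0"
    and top: "a (N+1) = c (N+1)" "\<phi> (a (N+1)) < \<phi> (a N)" "\<phi> (c (N+1)) < \<phi> (c N)"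
begin

lemma phi_eq: "\<phi> p = \<phi> q \<longleftrightarrow> p = q"
  using inj by (simp add: inj_eq)

lemma swap: "two_chains \<phi> N c a"
  using inj N a_mono a_anti c_mono c_anti bot top by unfold_locales auto

text \<open>Relative to the stop, outcomes at smaller budgets do not improve on \<open>z\<close> for
  player 1, and those at larger budgets do not improve on it for player 2.\<close>

lemma half_pareto:
  assumes "half_result \<phi> a c i z"
  shows "\<not> (z < a p \<and> \<phi> z < \<phi> (a p))" "\<not> (z < c p \<and> \<phi> z < \<phi> (c p))"
proof -
  from assms consider (ag) "agree \<phi> a c (i div 2) z" |
     (ls) l r where "left_stop \<phi> a c l r z" | (rs) l r where "right_stop \<phi> a c l r z"
    unfolding half_result_def by blast
  then have "\<not> (z < a p \<and> \<phi> z < \<phi> (a p)) \<and> \<not> (z < c p \<and> \<phi> z < \<phi> (c p))"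
  proof cases
    case ag
    let ?j = "i div 2"
    show ?thesis using ag a_mono[of p ?j] a_anti[of ?j p] c_mono[of p ?j] c_anti[of ?j p]
      unfolding agree_def by force
  next
    case (ls l r)
    show ?thesis using ls a_mono[of p "l-1"] a_anti[of "l-1" p] a_anti[of l p] c_mono[of p r] c_anti[of r p]
      unfolding left_stop_def live_def by force
  next
    case (rs l r)
    show ?thesis using rs a_mono[of p l] a_anti[of l p] c_mono[of p "r+1"] c_anti[of "r+1" p] c_mono[of p r]
      unfolding right_stop_def live_def by force
  qed
  then show "\<not> (z < a p \<and> \<phi> z < \<phi> (a p))" "\<not> (z < c p \<and> \<phi> z < \<phi> (c p))" by blast+
qed

text \<open>Narrowing a pair makes winning cheaper for both players, so both still want it. Hence a
  walk leaves the live pairs only once, and a pair that is not live cannot lie inside a live one;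
  the comparisons of stops below rest on this.\<close>

lemma live_mono:
  "live \<phi> a c l r \<Longrightarrow> l \<le> l' \<Longrightarrow> l' \<le> r' \<Longrightarrow> r' \<le> r \<Longrightarrow> live \<phi> a c l' r'"
  using a_mono[of l l'] a_anti[of l l'] c_mono[of r' r] c_anti[of r' r] by (auto simp: live_def)

lemma left_not_live: "left_stop \<phi> a c l r z \<Longrightarrow> \<not> live \<phi> a c (l-1) r"
  by (auto simp: left_stop_def live_def)
lemma right_not_live: "right_stop \<phi> a c l r z \<Longrightarrow> \<not> live \<phi> a c l (r+1)"
  by (auto simp: right_stop_def live_def)
lemma agree_not_live: "agree \<phi> a c j z \<or> agree \<phi> c a j z \<Longrightarrow> \<not> live \<phi> a c j j"
  by (auto simp: agree_def live_def)

section \<open>Change of the merged result between consecutive indices\<close>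

definition cross :: "int \<Rightarrow> bool" where
  "cross y \<longleftrightarrow> a (y-1) \<noteq> a y \<or> c (y-1) \<noteq> c y"

text \<open>Source of the halved grid: an index is about twice a budget, so if \<open>l\<close> and
  \<open>r\<close> are multiples of \<open>L\<close>, the budget is a multiple of
  \<open>L / 2\<close>.\<close>

definition jump :: "int \<Rightarrow> bool" where
  "jump i \<longleftrightarrow> (\<exists>l r. l + r = i \<and> l \<le> r \<and> cross l \<and> cross r)"

lemma jumpI: "l + r = i \<Longrightarrow> l \<le> r \<Longrightarrow> cross l \<Longrightarrow> cross r \<Longrightarrow> jump i"
  unfolding jump_def by blast

text \<open>Both pairs narrow to \<open>(j, j)\<close>, where one requires \<open>c j < a j\<close>
  and the other the converse.\<close>

lemma live_swap: "live \<phi> a c l r \<Longrightarrow> live \<phi> c a l' r' \<Longrightarrow> l \<le> j \<Longrightarrow> j \<le> r \<Longrightarrow> l' \<le> j \<Longrightarrow> j \<le> r' \<Longrightarrow> False"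
  using live_mono[of l r j j] two_chains.live_mono[OF swap, of l' r' j j] by (auto simp: live_def)

text \<open>For even \<open>i\<close> both indices look at the same diagonal point. For odd
  \<open>i\<close> the point moves by one, and a single crossing serves as both \<open>l\<close> and
  \<open>r\<close> of the jump.\<close>

lemma step_agree_agree:
  assumes "agree \<phi> a c (i div 2) z" "agree \<phi> a c ((i+1) div 2) z' \<or> agree \<phi> c a ((i+1) div 2) z'"
  shows "z \<le> z' \<and> (z \<noteq> z' \<longrightarrow> jump (i+1))"
proof (cases "even i")
  case True
  then have "(i+1) div 2 = i div 2" by presburger
  then show ?thesis using assms phi_eq by (force simp: agree_def)
next
  case False
  then have j: "(i+1) div 2 = i div 2 + 1" "i + 1 = (i div 2 + 1) + (i div 2 + 1)" by presburger+
  have "z \<noteq> z' \<longrightarrow> cross (i div 2 + 1)"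
    using assms phi_eq unfolding agree_def cross_def j by force
  moreover have "z \<le> z'" using assms a_mono[of "i div 2" "i div 2 + 1"] c_mono[of "i div 2" "i div 2 + 1"] 
    unfolding agree_def j by force
  ultimately show ?thesis using j(2) jumpI by (metis order_refl)
qed

text \<open>Agreement at \<open>i div 2\<close> forbids live pairs around this point, so the live
  pair of the next index must be the new diagonal point itself.\<close>

lemma step_agree_left:
  assumes ag: "agree \<phi> a c (i div 2) z \<or> agree \<phi> c a (i div 2) z" and st: "left_stop \<phi> a c l r z'" "l + r = i + 1"
  shows "z \<le> z' \<and> (z \<noteq> z' \<longrightarrow> jump (i+1))"
proof -
  have nl: "\<not> live \<phi> a c (i div 2) (i div 2)" using agree_not_live[OF ag] .
  have lv: "live \<phi> a c l r" using st by (auto simp: left_stop_def)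
  have lr: "l \<le> r" using lv by (auto simp: live_def)
  have "l = r"
  proof (rule ccontr)
    assume "l \<noteq> r"
    then have "l \<le> i div 2" "i div 2 \<le> r" using st(2) lr by presburger+
    then show False using nl live_mono[OF lv] by blast
  qed
  then have j: "i div 2 = l - 1" "r = l" "i + 1 = l + l" using st(2) by presburger+
  have "z \<noteq> z' \<longrightarrow> cross l" using ag st(1) phi_eq unfolding agree_def left_stop_def live_def cross_def j by force
  moreover have "z \<le> z'" using ag st(1) a_mono[of "l-1" l] c_mono[of "l-1" l] unfolding agree_def left_stop_def live_def j by force
  ultimately show ?thesis using j jumpI by (metis order_refl)
qed

lemma step_right_agree:
  assumes ag: "agree \<phi> a c ((i+1) div 2) z' \<or> agree \<phi> c a ((i+1) div 2) z'" and st: "right_stop \<phi> a c l r z" "l + r = i - 1"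
  shows "z \<le> z' \<and> (z \<noteq> z' \<longrightarrow> jump (i+1))"
proof -
  let ?j = "(i+1) div 2"
  have nl: "\<not> live \<phi> a c ?j ?j" using agree_not_live[OF ag] .
  have lv: "live \<phi> a c l r" using st by (auto simp: right_stop_def)
  have lr: "l \<le> r" using lv by (auto simp: live_def)
  have "l = r"
  proof (rule ccontr)
    assume "l \<noteq> r"
    then have "l \<le> ?j" "?j \<le> r" using st(2) lr by presburger+
    then show False using nl live_mono[OF lv] by blast
  qed
  then have j: "?j = l + 1" "r = l" "i + 1 = (l+1) + (l+1)" using st(2) by presburger+
  have "z \<noteq> z' \<longrightarrow> cross (l+1)" using ag st(1) phi_eq unfolding agree_def right_stop_def live_def cross_def j by force
  moreover have "z \<le> z'" using ag st(1) a_mono[of l "l+1"] c_mono[of l "l+1"] unfolding agree_def right_stop_def live_def j by force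
  ultimately show ?thesis using j jumpI by (metis order_refl)
qed

text \<open>Every pair \<open>l <= r\<close> with sum \<open>i\<close> contains
  \<open>i div 2\<close>, where agreement forbids liveness.\<close>

lemma step_agree_right:
  assumes ag: "agree \<phi> a c (i div 2) z \<or> agree \<phi> c a (i div 2) z" and st: "right_stop \<phi> a c l r z'" "l + r = i"
  shows False
proof -
  have lv: "live \<phi> a c l r" using st by (auto simp: right_stop_def)
  have "l \<le> r" using lv by (auto simp: live_def)
  then have "l \<le> i div 2" "i div 2 \<le> r" using st(2) by presburger+
  then show False using agree_not_live[OF ag] live_mono[OF lv] by blast
qed

lemma step_left_agree:
  assumes ag: "agree \<phi> a c ((i+1) div 2) z \<or> agree \<phi> c a ((i+1) div 2) z" and st: "left_stop \<phi> a c l r z'" "l + r = i"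
  shows False
proof -
  have lv: "live \<phi> a c l r" using st by (auto simp: left_stop_def)
  have "l \<le> r" "\<not> (l = r \<and> odd i)" using lv st(2) by (auto simp: live_def)
  then have "l \<le> (i+1) div 2" "(i+1) div 2 \<le> r" using st(2) by presburger+
  then show False using agree_not_live[OF ag] live_mono[OF lv] by blast
qed

text \<open>Neither of the first pairs that are not live may lie inside the other live pair. As the
  sums differ by one, only \<open>l' = l\<close> and \<open>r' = r + 1\<close> remain. The other
  cases of equal orientation follow the same scheme.\<close>

lemma step_left_left:
  assumes st: "left_stop \<phi> a c l r z" "l + r = i" and st': "left_stop \<phi> a c l' r' z'" "l' + r' = i + 1"
  shows "z \<le> z' \<and> (z \<noteq> z' \<longrightarrow> jump (i+1))"
proof -
  have lv: "live \<phi> a c l r" "live \<phi> a c l' r'" "\<not> live \<phi> a c (l-1) r" "\<not> live \<phi> a c (l'-1) r'"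
    using left_not_live[OF st(1)] left_not_live[OF st'(1)] st(1) st'(1) by (auto simp: left_stop_def)
  have lr: "l \<le> r" "l' \<le> r'" using lv by (auto simp: live_def)
  have "l' = l"
  proof (rule linorder_cases[of l' l])
    assume "l' < l" then show ?thesis using live_mono[OF lv(2), of "l-1" r] lv(3) lr st(2) st'(2) by auto
  next
    assume "l < l'" then show ?thesis using live_mono[OF lv(1), of "l'-1" r'] lv(4) lr st(2) st'(2) by auto
  qed
  then have j: "l' = l" "r' = r + 1" using st(2) st'(2) by auto
  have "z \<noteq> z' \<longrightarrow> cross l \<and> cross (r+1)"
    using st(1) st'(1) phi_eq unfolding left_stop_def live_def cross_def j by force
  moreover have "z \<le> z'" using st(1) st'(1) a_mono[of "l-1" l] c_mono[of r "r+1"] unfolding left_stop_def live_def j by force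
  ultimately show ?thesis unfolding jump_def using j st'(2) lr by blast
qed

lemma step_left_right:
  assumes st: "left_stop \<phi> a c l r z" "l + r = i" and st': "right_stop \<phi> a c l' r' z'" "l' + r' = i"
  shows "z \<le> z' \<and> (z \<noteq> z' \<longrightarrow> jump (i+1))"
proof -
  have lv: "live \<phi> a c l r" "live \<phi> a c l' r'" "\<not> live \<phi> a c (l-1) r" "\<not> live \<phi> a c l' (r'+1)"
    using left_not_live[OF st(1)] right_not_live[OF st'(1)] st(1) st'(1) by (auto simp: left_stop_def right_stop_def)
  have lr: "l \<le> r" "l' \<le> r'" using lv by (auto simp: live_def)
  have "l' = l"
  proof (rule linorder_cases[of l' l])
    assume "l' < l" then show ?thesis using live_mono[OF lv(2), of "l-1" r] lv(3) lr st(2) st'(2) by auto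
  next
    assume "l < l'" then show ?thesis using live_mono[OF lv(1), of "l'" "r'+1"] lv(4) lr st(2) st'(2) by auto
  qed
  then have j: "l' = l" "r' = r" using st(2) st'(2) by auto
  have "z \<noteq> z' \<longrightarrow> cross l \<and> cross (r+1)"
    using st(1) st'(1) phi_eq unfolding left_stop_def right_stop_def live_def cross_def j by force
  moreover have "z \<le> z'" using st(1) st'(1) a_mono[of "l-1" l] c_mono[of r "r+1"] unfolding left_stop_def right_stop_def live_def j by force
  ultimately show ?thesis unfolding jump_def using j st'(2) lr by (metis add.assoc zle_add1_eq_le zless_add1_eq)
qed

lemma step_right_right:
  assumes st: "right_stop \<phi> a c l r z" "l + r = i - 1" and st': "right_stop \<phi> a c l' r' z'" "l' + r' = i"
  shows "z \<le> z' \<and> (z \<noteq> z' \<longrightarrow> jump (i+1))"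
proof -
  have lv: "live \<phi> a c l r" "live \<phi> a c l' r'" "\<not> live \<phi> a c l (r+1)" "\<not> live \<phi> a c l' (r'+1)"
    using right_not_live[OF st(1)] right_not_live[OF st'(1)] st(1) st'(1) by (auto simp: right_stop_def)
  have lr: "l \<le> r" "l' \<le> r'" using lv by (auto simp: live_def)
  have "r' = r"
  proof (rule linorder_cases[of r' r])
    assume "r < r'" then show ?thesis using live_mono[OF lv(2), of l "r+1"] lv(3) lr st(2) st'(2) by auto
  next
    assume "r' < r" then show ?thesis using live_mono[OF lv(1), of "l'" "r'+1"] lv(4) lr st(2) st'(2) by auto
  qed
  then have j: "r' = r" "l' = l + 1" "i = l + 1 + r" using st(2) st'(2) by auto
  have "z \<noteq> z' \<longrightarrow> cross (l+1) \<and> cross (r+1)"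
    using st(1) st'(1) phi_eq unfolding right_stop_def live_def cross_def j by force
  moreover have "z \<le> z'" using st(1) st'(1) a_mono[of "l" "l+1"] a_anti[of l "l+1"] c_mono[of r "r+1"] unfolding right_stop_def live_def j by force
  moreover have "(l+1)+(r+1) = i+1" "l + 1 \<le> r + 1" using j lr by auto
  ultimately show ?thesis unfolding jump_def by blast
qed

lemma step_right_left:
  assumes st: "right_stop \<phi> a c l r z" "l + r = i - 1" and st': "left_stop \<phi> a c l' r' z'" "l' + r' = i + 1"
  shows "z \<le> z' \<and> (z \<noteq> z' \<longrightarrow> jump (i+1))"
proof -
  have lv: "live \<phi> a c l r" "live \<phi> a c l' r'" "\<not> live \<phi> a c l (r+1)" "\<not> live \<phi> a c (l'-1) r'"
    using right_not_live[OF st(1)] left_not_live[OF st'(1)] st(1) st'(1) by (auto simp: right_stop_def left_stop_def)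
  have lr: "l \<le> r" "l' \<le> r'" using lv by (auto simp: live_def)
  have "l' = l + 1"
  proof (rule linorder_cases[of l' "l+1"])
    assume "l' < l+1" then show ?thesis using live_mono[OF lv(2), of l "r+1"] lv(3) lr st(2) st'(2) by auto
  next
    assume "l+1 < l'" then show ?thesis using live_mono[OF lv(1), of "l'-1" "r'"] lv(4) lr st(2) st'(2) by auto
  qed
  then have j: "r' = r + 1" "l' = l + 1" using st(2) st'(2) by auto
  have "z \<noteq> z' \<longrightarrow> cross (l+1) \<and> cross (r+1)"
    using st(1) st'(1) phi_eq unfolding right_stop_def left_stop_def live_def cross_def j by force
  moreover have "z \<le> z'" using st(1) st'(1) a_mono[of "l" "l+1"] c_mono[of r "r+1"] unfolding right_stop_def left_stop_def live_def j by force
  ultimately show ?thesis unfolding jump_def using j st'(2) lr by blast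
qed

text \<open>The players exchange their favourite successors between the two indices. By
  \<open>live_swap\<close> the live pairs cannot overlap, so they are two adjacent diagonal
  points.\<close>

lemma step_right_left_swap:
  assumes st: "right_stop \<phi> a c l r z" "l + r = i - 1" and st': "left_stop \<phi> c a l' r' z'" "l' + r' = i + 1"
  shows "z \<le> z' \<and> (z \<noteq> z' \<longrightarrow> jump (i+1))"
proof -
  have lv: "live \<phi> a c l r" "live \<phi> c a l' r'"
    using st(1) st'(1) by (auto simp: right_stop_def left_stop_def)
  have lr: "l \<le> r" "l' \<le> r'" using lv by (auto simp: live_def)
  have lt: "r < l'" using live_swap[OF lv, of l] live_swap[OF lv, of l'] lr st(2) st'(2) by (smt (verit))
  then have j: "r = l" "l' = l + 1" "r' = l+1" "i + 1 = (l+1) + (l+1)" using st(2) st'(2) lr by auto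
  have "z \<noteq> z' \<longrightarrow> cross (l+1)"
    using st(1) st'(1) phi_eq unfolding right_stop_def left_stop_def live_def cross_def j by force
  moreover have "z \<le> z'" using st(1) st'(1) a_mono[of "l" "l+1"] c_mono[of l "l+1"] a_anti[of "l" "l+1"] c_anti[of l "l+1"]
    unfolding right_stop_def left_stop_def live_def j by force
  ultimately show ?thesis using j jumpI by (metis order_refl)
qed

text \<open>Apart from \<open>step_right_left_swap\<close>, stops of opposite orientation would
  contain a common point and are excluded by \<open>live_swap\<close>.\<close>

lemma half_step:
  assumes "half_result \<phi> a c i z" "merged \<phi> a c (i+1) z'"
  shows "z \<le> z' \<and> (z \<noteq> z' \<longrightarrow> jump (i+1))"
proof -
  interpret sw: two_chains \<phi> N c a by (rule swap)
  from assms(1) consider (ag) "agree \<phi> a c (i div 2) z" |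
     (ls) l r where "l + r = i" "left_stop \<phi> a c l r z" | (rs) l r where "l + r = i - 1" "right_stop \<phi> a c l r z"
    unfolding half_result_def by blast
  note first = this
  from assms(2) consider (ag) "agree \<phi> a c ((i+1) div 2) z' \<or> agree \<phi> c a ((i+1) div 2) z'" |
     (ls) l r where "l + r = i + 1" "left_stop \<phi> a c l r z'" | (rs) l r where "l + r = i" "right_stop \<phi> a c l r z'" |
     (ls') l r where "l + r = i + 1" "left_stop \<phi> c a l r z'" | (rs') l r where "l + r = i" "right_stop \<phi> c a l r z'"
    unfolding merged_def half_result_def by auto
  note second = this
  have j: "sw.jump = jump" by (auto simp: fun_eq_iff sw.jump_def jump_def sw.cross_def cross_def)
  show ?thesis using first
  proof cases
    case ag
    show ?thesis using second
      by cases (use ag step_agree_agree step_agree_left step_agree_right sw.step_agree_left sw.step_agree_right j in metis)+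
  next
    case (ls l r)
    have lv: "live \<phi> a c l r" "l \<le> r" using ls by (auto simp: left_stop_def live_def)
    show ?thesis using second
    proof cases
      case ag then show ?thesis using step_left_agree ls by blast
    next
      case (ls l' r') then show ?thesis using step_left_left \<open>left_stop \<phi> a c l r z\<close> \<open>l + r = i\<close> by blast
    next
      case (rs l' r') then show ?thesis using step_left_right ls by blast
    next
      case (ls' l' r')
      then have lv': "live \<phi> c a l' r'" "l' \<le> r'" by (auto simp: left_stop_def live_def)
      have "\<not> (l = r \<and> odd i)" using ls(1) by auto
      then have "l \<le> (i+1) div 2" "(i+1) div 2 \<le> r" using lv(2) ls(1) by presburger+
      moreover have "l' \<le> (i+1) div 2" "(i+1) div 2 \<le> r'" using lv'(2) ls'(1) by presburger+
      ultimately show ?thesis using live_swap[OF lv(1) lv'(1)] by blast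
    next
      case (rs' l' r')
      then have lv': "live \<phi> c a l' r'" "l' \<le> r'" by (auto simp: right_stop_def live_def)
      have "l \<le> i div 2" "i div 2 \<le> r" using lv(2) ls(1) by presburger+
      moreover have "l' \<le> i div 2" "i div 2 \<le> r'" using lv'(2) rs'(1) by presburger+
      ultimately show ?thesis using live_swap[OF lv(1) lv'(1)] by blast
    qed
  next
    case (rs l r)
    have lv: "live \<phi> a c l r" "l \<le> r" using rs by (auto simp: right_stop_def live_def)
    show ?thesis using second
    proof cases
      case ag then show ?thesis using step_right_agree rs by blast
    next
      case (ls l' r') then show ?thesis using step_right_left rs by blast
    next
      case (rs l' r') then show ?thesis using step_right_right \<open>right_stop \<phi> a c l r z\<close> \<open>l + r = i - 1\<close> by blast
    next
      case (ls' l' r') then show ?thesis using step_right_left_swap rs by blast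
    next
      case (rs' l' r')
      then have lv': "live \<phi> c a l' r'" "l' \<le> r'" by (auto simp: right_stop_def live_def)
      have "\<not> (l = r \<and> even i)" using rs(1) by presburger
      then have "l \<le> i div 2" "i div 2 \<le> r" using lv(2) rs(1) by presburger+
      moreover have "l' \<le> i div 2" "i div 2 \<le> r'" using lv'(2) rs'(1) by presburger+
      ultimately show ?thesis using live_swap[OF lv(1) lv'(1)] by blast
    qed
  qed
qed

lemma merged_pareto:
  assumes "merged \<phi> a c i z"
  shows "\<not> (z < a p \<and> \<phi> z < \<phi> (a p))" "\<not> (z < c p \<and> \<phi> z < \<phi> (c p))"
  using assms half_pareto two_chains.half_pareto[OF swap] unfolding merged_def by blast+

lemma merged_step:
  assumes "merged \<phi> a c i z" "merged \<phi> a c (i+1) z'"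
  shows "z \<le> z' \<and> (z \<noteq> z' \<longrightarrow> jump (i+1))"
proof -
  interpret sw: two_chains \<phi> N c a by (rule swap)
  have j: "sw.jump = jump" by (auto simp: fun_eq_iff sw.jump_def jump_def sw.cross_def cross_def)
  from assms(1) consider "half_result \<phi> a c i z" | "half_result \<phi> c a i z" unfolding merged_def by blast
  then show ?thesis
    using half_step[OF _ assms(2)] sw.half_step[of i z z'] assms(2) unfolding j merged_swap[of \<phi> c a] by cases
qed

section \<open>Existence of a merged result\<close>

lemma left_stop_exists: "live \<phi> a c l r \<Longrightarrow> \<not> live \<phi> a c (l-1) r \<Longrightarrow> \<exists>z. left_stop \<phi> a c l r z"
  unfolding left_stop_def by (cases "a (l-1) \<le> c r") (auto simp: live_def)

lemma right_stop_exists: "live \<phi> a c l r \<Longrightarrow> \<not> live \<phi> a c l (r+1) \<Longrightarrow> \<exists>z. right_stop \<phi> a c l r z"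
  unfolding right_stop_def by (cases "\<phi> (c (r+1)) \<le> \<phi> (a l)") (auto simp: live_def)

lemma half_exists:
  assumes "live \<phi> a c (i div 2) (i div 2)" "0 \<le> i"
  shows "\<exists>z. half_result \<phi> a c i z"
proof -
  \<comment> \<open>\<open>t\<close> counts the moves of the walk: raising it by one lowers
    \<open>l\<close> or raises \<open>r\<close>, whichever has its turn.\<close>
  let ?l = "\<lambda>t::nat. (i - int t) div 2" and ?r = "\<lambda>t::nat. (i + int t) div 2"
  \<comment> \<open>After \<open>i + 1\<close> moves \<open>l\<close> is negative, so
    \<open>a l\<close> is at most the common value at \<open>-1\<close>, and player 1 cannot prefer
    winning.\<close>
  have "\<not> live \<phi> a c (?l (nat i + 1)) (?r (nat i + 1))"
  proof
    assume L: "live \<phi> a c (?l (nat i + 1)) (?r (nat i + 1))"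
    have "?l (nat i + 1) \<le> - 1" "-1 \<le> ?r (nat i + 1)" using assms(2) by auto
    then show False using L a_mono[of "?l (nat i + 1)" "-1"] c_mono[of "-1" "?r (nat i + 1)"] bot(1)
      by (auto simp: live_def)
  qed
  moreover have "live \<phi> a c (?l 0) (?r 0)" using assms(1) by simp
  ultimately obtain t where t: "live \<phi> a c (?l t) (?r t)" "\<not> live \<phi> a c (?l (Suc t)) (?r (Suc t))"
    using nat_induct[of "\<lambda>t. live \<phi> a c (?l t) (?r t)"] by blast
  show ?thesis
  proof (cases "even (i + int t)")
    case True
    then have s: "?l t + ?r t = i" "?l (Suc t) = ?l t - 1" "?r (Suc t) = ?r t" by presburger+
    have "\<exists>z. left_stop \<phi> a c (?l t) (?r t) z"
      using t unfolding s by (rule left_stop_exists)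
    then show ?thesis unfolding half_result_def using s(1) by blast
  next
    case False
    then have s: "?l t + ?r t = i - 1" "?l (Suc t) = ?l t" "?r (Suc t) = ?r t + 1" by presburger+
    have "\<exists>z. right_stop \<phi> a c (?l t) (?r t) z"
      using t unfolding s by (rule right_stop_exists)
    then show ?thesis unfolding half_result_def using s(1) by blast
  qed
qed

text \<open>On the diagonal the players either agree on a successor or strictly want different ones;
  injectivity of \<phi> leaves no third case.\<close>

lemma merged_exists:
  assumes "0 \<le> i"
  shows "\<exists>z. merged \<phi> a c i z"
proof -
  let ?j = "i div 2"
  have "live \<phi> a c ?j ?j \<or> live \<phi> c a ?j ?j \<or> agree \<phi> a c ?j (a ?j) \<or> agree \<phi> c a ?j (c ?j)"
    unfolding live_def agree_def using phi_eq[of "a ?j" "c ?j"] by force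
  then have "(\<exists>z. half_result \<phi> a c i z) \<or> (\<exists>z. half_result \<phi> c a i z)"
    using half_exists[OF _ assms] two_chains.half_exists[OF swap _ assms]
    unfolding half_result_def by metis
  then show ?thesis unfolding merged_def by blast
qed

lemma step_index:
  assumes "P (lo::int)" "\<not> P hi" "lo \<le> hi"
  obtains p where "lo \<le> p" "p < hi" "P p" "\<not> P (p+1)"
proof -
  have "\<exists>p. lo \<le> p \<and> p < lo + int n \<and> P p \<and> \<not> P (p+1)" if "\<not> P (lo + int n)" for n
    using that
  proof (induction n)
    case (Suc n)
    show ?case
    proof (cases "P (lo + int n)")
      case True
      then show ?thesis using Suc.prems by (intro exI[of _ "lo + int n"]) (simp add: algebra_simps)
    next
      case False
      then show ?thesis using Suc.IH by force
    qed
  qed (use assms in simp)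
  from this[of "nat (hi - lo)"] assms that show ?thesis by auto
qed

text \<open>The place where \<open>c q\<close> ends a walk is found along \<open>a\<close>. If the
  last \<open>p\<close> with \<open>a p <= c q\<close> lies below \<open>q\<close>, there is a left
  stop at \<open>(p + 1, q)\<close>; otherwise there is agreement at \<open>q\<close>, or a right
  stop with exchanged roles at the last \<open>r\<close> where player 2 still prefers
  \<open>a r\<close>. Only odd indices are budgets; a wrong parity is corrected by moving
  \<open>q\<close> to a neighbour with the same \<open>c\<close>, which exists by
  \<open>separate\<close>.\<close>

lemma undominated_attained:
  assumes q: "0 \<le> q" "q \<le> N" and und: "\<And>p. \<not> (c q < a p \<and> \<phi> (c q) < \<phi> (a p))"
    and separate: "\<And>y. \<not> (cross y \<and> cross (y+1))" and crossN: "cross (N+1)" and cross0: "cross 0"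
  shows "\<exists>x. 0 \<le> x \<and> x \<le> N \<and> merged \<phi> a c (2*x+1) (c q)"
proof -
  have "a (-1) \<le> c q" using bot c_mono[of "-1" q] q by simp
  moreover have "\<not> a (N+1) \<le> c q" 
    using top c_anti[of q N] c_mono[of q "N+1"] q phi_eq[of "a (N+1)" "c q"] by force
  moreover have "-1 \<le> N + 1" using N by simp
  ultimately obtain p where p: "-1 \<le> p" "p < N+1" "a p \<le> c q" and "\<not> a (p+1) \<le> c q"
    by (rule step_index[of "\<lambda>y. a y \<le> c q"])
  then have p4: "c q < a (p+1)" by simp
  note p = p p4
  have less: "\<phi> (a (p+1)) < \<phi> (c q)" using und[of "p+1"] p(4) phi_eq[of "a (p+1)" "c q"] by force
  have left: "merged \<phi> a c (p+1+q') (c q)" if "p + 1 \<le> q'" "c q' = c q" for q'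
  proof -
    have "left_stop \<phi> a c (p+1) q' (c q)" using that p less by (auto simp: left_stop_def live_def)
    then show ?thesis unfolding merged_def half_result_def by blast
  qed
  show ?thesis
  proof (cases "p + 1 \<le> q")
    case True
    have "\<exists>q'. p + 1 \<le> q' \<and> q' \<le> N \<and> c q' = c q \<and> even (p + q')"
    proof (cases "even (p+q)")
      case False
      show ?thesis
      proof (cases "cross (q+1)")
        case True
        then have "\<not> cross q" using separate by blast
        then have e: "a (q-1) = a q" "c (q-1) = c q" by (auto simp: cross_def)
        \<comment> \<open>If \<open>q = p + 1\<close>, the constancy of \<open>a\<close> from
          \<open>q - 1\<close> to \<open>q\<close> would contradict
          \<open>a p <= c q < a (p + 1)\<close>.\<close>
        have "p + 1 \<noteq> q" using e p by auto
        then show ?thesis using e False \<open>p + 1 \<le> q\<close> q by (intro exI[of _ "q-1"]) auto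
      next
        case nc: False
        \<comment> \<open>\<open>crossN\<close> guarantees a step at \<open>N + 1\<close>; since
          there is none at \<open>q + 1\<close>, this budget is still in range.\<close>
        then have "c (q+1) = c q" "q \<noteq> N" using crossN by (auto simp: cross_def)
        then show ?thesis using False True q by (intro exI[of _ "q+1"]) auto
      qed
    qed (use True q in auto)
    then obtain q' where q': "p + 1 \<le> q'" "q' \<le> N" "c q' = c q" "even (p + q')" by blast
    then obtain x where x: "p + q' = 2 * x" by blast
    have "merged \<phi> a c (2*x+1) (c q)" using left[OF q'(1,3)] x by (simp add: algebra_simps)
    moreover have "0 \<le> x" "x \<le> N" using x q' p by linarith+
    ultimately show ?thesis by blast
  next
    case False
    then have aq: "a q \<le> c q" using a_mono[of q p] p by auto
    show ?thesis
    proof (cases "\<phi> (a q) \<le> \<phi> (c q)")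
      case True
      then have "agree \<phi> c a ((2*q+1) div 2) (c q)" using aq by (auto simp: agree_def)
      then show ?thesis using q unfolding merged_def half_result_def by blast
    next
      case gt: False
      have "\<not> \<phi> (c q) < \<phi> (a (N+1))" using top c_anti[of q N] q by force
      moreover have "\<phi> (c q) < \<phi> (a q)" "q \<le> N + 1" using gt q by auto
      ultimately obtain r where r: "q \<le> r" "r < N+1" "\<phi> (c q) < \<phi> (a r)" and "\<not> \<phi> (c q) < \<phi> (a (r+1))"
        using step_index[of "\<lambda>y. \<phi> (c q) < \<phi> (a y)" q "N+1"] by blast
      then have r4: "\<phi> (a (r+1)) \<le> \<phi> (c q)" by simp
      note r = r r4
      have less': "a r < c q" using und[of r] r phi_eq[of "a r" "c q"] by force
      have right: "merged \<phi> a c (q'+r+1) (c q)" if "q' \<le> r" "c q' = c q" for q'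
      proof -
        have "right_stop \<phi> c a q' r (c q)" using that r less' by (auto simp: right_stop_def live_def)
        then show ?thesis unfolding merged_def half_result_def by fastforce
      qed
      have "\<exists>q'. 0 \<le> q' \<and> q' \<le> r \<and> c q' = c q \<and> even (q' + r)"
      proof (cases "even (q+r)")
        case False
        show ?thesis
        proof (cases "cross q")
          case True
          then have "c (q+1) = c q" using separate[of q] by (auto simp: cross_def)
          moreover have "q \<noteq> r" using False by auto
          ultimately show ?thesis using False r q by (intro exI[of _ "q+1"]) auto
        next
          case nc: False
          then have "c (q-1) = c q" "q \<noteq> 0" using cross0 by (auto simp: cross_def)
          then show ?thesis using False r q by (intro exI[of _ "q-1"]) auto
        qed
      qed (use r q in auto)
      then obtain q' where q': "0 \<le> q'" "q' \<le> r" "c q' = c q" "even (q' + r)" by blast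
      then obtain x where x: "q' + r = 2 * x" by blast
      have "merged \<phi> a c (2*x+1) (c q)" using right[OF q'(2,3)] x by (simp add: algebra_simps)
      moreover have "0 \<le> x" "x \<le> N" using x q' r by linarith+
      ultimately show ?thesis by blast
    qed
  qed
qed

section \<open>The one-shot bidding game\<close>

definition best1 :: "int \<Rightarrow> int" where "best1 y = max (a y) (c y)"
definition best2 :: "int \<Rightarrow> int" where "best2 y = (if \<phi> (c y) \<le> \<phi> (a y) then a y else c y)"

text \<open>The auction rests at \<open>(m, m)\<close> if overbidding by one does not pay for player
  2; \<open>stop_p2\<close> is rest at \<open>(m - 1, m)\<close>, where matching does not pay for
  player 1.\<close>

definition stop_p1 :: "int \<Rightarrow> int \<Rightarrow> bool" where
  "stop_p1 x m \<longleftrightarrow> \<phi> (best2 (x+m+1)) \<le> \<phi> (best1 (x-m))"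
definition stop_p2 :: "int \<Rightarrow> int \<Rightarrow> bool" where
  "stop_p2 x m \<longleftrightarrow> best1 (x-m) \<le> best2 (x+m)"

definition last_bid :: "int \<Rightarrow> int" where
  "last_bid x = int (LEAST m. stop_p1 x (int m) \<or> stop_p2 x (int m))"

definition stage :: "int \<Rightarrow> int \<Rightarrow> (int \<Rightarrow> int) \<Rightarrow> int \<Rightarrow> (int \<Rightarrow> int) \<Rightarrow> int" where
  "stage x b1 f1 b2 f2 = (if b2 \<le> b1 then f1 (x - b1) else f2 (x + b2))"

definition nash :: "int \<Rightarrow> int \<Rightarrow> (int \<Rightarrow> int) \<Rightarrow> int \<Rightarrow> (int \<Rightarrow> int) \<Rightarrow> bool" where
  "nash x b1 f1 b2 f2 \<longleftrightarrow> 0 \<le> b1 \<and> b1 \<le> x \<and> 0 \<le> b2 \<and> b2 \<le> N - x \<and> f1 \<in> {a, c} \<and> f2 \<in> {a, c} \<and>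
     (\<forall>b f. 0 \<le> b \<longrightarrow> b \<le> x \<longrightarrow> f \<in> {a, c} \<longrightarrow> stage x b f b2 f2 \<le> stage x b1 f1 b2 f2) \<and>
     (\<forall>b f. 0 \<le> b \<longrightarrow> b \<le> N - x \<longrightarrow> f \<in> {a, c} \<longrightarrow> \<phi> (stage x b1 f1 b f) \<le> \<phi> (stage x b1 f1 b2 f2))"

text \<open>If both stops hold with the same outcome, \<open>(m, m)\<close> is taken, because for
  equal winning bids the order puts the higher losing bid lower. The loser must plan a best move
  too, so that the result of an underbid by the winner is known.\<close>

definition canonical :: "int \<Rightarrow> int \<Rightarrow> (int \<Rightarrow> int) \<Rightarrow> int \<Rightarrow> (int \<Rightarrow> int) \<Rightarrow> bool" where
  "canonical x b1 f1 b2 f2 \<longleftrightarrow> f1 \<in> {a, c} \<and> f2 \<in> {a, c} \<and> b2 = last_bid x \<and> f1 (x - b1) = best1 (x - b1) \<and> f2 (x + b2) = best2 (x + b2) \<and>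
     b1 = (if stop_p1 x b2 \<and> best2 (x+b2) \<le> best1 (x-b2) then b2 else b2 - 1)"

lemma canonicalD:
  assumes "canonical x b1 f1 b2 f2"
  shows "b2 = last_bid x" "b1 = (if stop_p1 x b2 \<and> best2 (x+b2) \<le> best1 (x-b2) then b2 else b2 - 1)"
    "f1 \<in> {a, c}" "f2 \<in> {a, c}" "f1 (x - b1) = best1 (x - b1)" "f2 (x + b2) = best2 (x + b2)"
  using assms unfolding canonical_def by blast+

lemma best1_ge: "f \<in> {a, c} \<Longrightarrow> f y \<le> best1 y" by (auto simp: best1_def)
lemma best2_ge: "f \<in> {a, c} \<Longrightarrow> \<phi> (f y) \<le> \<phi> (best2 y)" by (auto simp: best2_def)
lemma best1_cases: "best1 y = a y \<or> best1 y = c y" by (auto simp: best1_def)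
lemma best2_cases: "best2 y = a y \<or> best2 y = c y" by (auto simp: best2_def)

lemma best1_attained: obtains f where "f \<in> {a, c}" "f y = best1 y"
  using best1_cases[of y] by (metis insertI1 insertI2)
lemma best2_attained: obtains f where "f \<in> {a, c}" "f y = best2 y"
  using best2_cases[of y] by (metis insertI1 insertI2)

lemma canonical_exists: "\<exists>b1 f1 b2 f2. canonical x b1 f1 b2 f2"
proof -
  define b2 where "b2 = last_bid x"
  define b1 where "b1 = (if stop_p1 x b2 \<and> best2 (x+b2) \<le> best1 (x-b2) then b2 else b2 - 1)"
  obtain f1 where "f1 \<in> {a,c}" "f1 (x - b1) = best1 (x - b1)" by (rule best1_attained)
  moreover obtain f2 where "f2 \<in> {a,c}" "f2 (x + b2) = best2 (x + b2)" by (rule best2_attained)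
  ultimately have "canonical x b1 f1 b2 f2" unfolding canonical_def b2_def[symmetric] b1_def[symmetric] by simp
  then show ?thesis by blast
qed

lemma best1_mono: "x \<le> y \<Longrightarrow> best1 x \<le> best1 y" using a_mono[of x y] c_mono[of x y] by (auto simp: best1_def)
lemma best2_anti: "x \<le> y \<Longrightarrow> \<phi> (best2 y) \<le> \<phi> (best2 x)" using a_anti[of x y] c_anti[of x y] by (auto simp: best2_def)

lemma bot_le: "-1 \<le> y \<Longrightarrow> best1 (-1) \<le> a y \<and> best1 (-1) \<le> c y"
  using a_mono[of "-1" y] c_mono[of "-1" y] bot(1) by (auto simp: best1_def)

lemma bot_less: "0 \<le> y \<Longrightarrow> best1 (-1) < a y \<and> best1 (-1) < c y"
  using a_mono[of "0" y] c_mono[of "0" y] bot by (auto simp: best1_def)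

lemma top_le: "y \<le> N+1 \<Longrightarrow> \<phi> (best2 (N+1)) \<le> \<phi> (a y) \<and> \<phi> (best2 (N+1)) \<le> \<phi> (c y)"
  using a_anti[of y "N+1"] c_anti[of y "N+1"] top(1) by (auto simp: best2_def)

context
  fixes x :: int
  assumes x: "0 \<le> x" "x \<le> N"
begin

text \<open>A bid \<open>x + 1\<close> leaves player 1 the budget \<open>-1\<close> with her worst
  outcome. In \<open>stop_p1_broke\<close> player 2's overbid likewise leads to
  \<open>N + 1\<close>.\<close>

lemma stop_p2_broke: "stop_p2 x (x+1)"
  using bot_le[of "2*x+1"] x best2_cases[of "2*x+1"] by (auto simp: stop_p2_def algebra_simps)

lemma stop_p1_broke: "stop_p1 x (N-x)"
  using top_le[of "2*x-N"] x best1_cases[of "2*x-N"] by (auto simp: stop_p1_def algebra_simps)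

lemma last_bid: "stop_p1 x (last_bid x) \<or> stop_p2 x (last_bid x)" "0 \<le> last_bid x"
    "last_bid x \<le> x + 1" "last_bid x \<le> N - x"
proof -
  let ?P = "\<lambda>m. stop_p1 x (int m) \<or> stop_p2 x (int m)"
  have P: "?P (nat (x+1))" "?P (nat (N-x))" using stop_p1_broke stop_p2_broke x by auto
  show "stop_p1 x (last_bid x) \<or> stop_p2 x (last_bid x)" unfolding last_bid_def using LeastI[of ?P, OF P(1)] .
  show "0 \<le> last_bid x" by (simp add: last_bid_def)
  show "last_bid x \<le> x + 1" "last_bid x \<le> N - x"
    unfolding last_bid_def using Least_le[of ?P, OF P(1)] Least_le[of ?P, OF P(2)] x by linarith+
qed

lemma last_bid_least:
  assumes "0 \<le> m" "stop_p1 x m \<or> stop_p2 x m" shows "last_bid x \<le> m"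
  unfolding last_bid_def using Least_le[of "\<lambda>m. stop_p1 x (int m) \<or> stop_p2 x (int m)" "nat m"] assms by auto

text \<open>Rules out the meaningless pair \<open>(-1, 0)\<close>: an auction that ends at bid 0 is
  won by player 1.\<close>

lemma stop_zero: "stop_p2 x 0 \<Longrightarrow> stop_p1 x 0" "best2 x \<le> best1 x"
proof -
  show le: "best2 x \<le> best1 x" using best1_ge best2_cases[of x] by force
  assume "stop_p2 x 0"
  then have "best2 x = best1 x" using le by (simp add: stop_p2_def)
  then show "stop_p1 x 0" using best2_anti[of x "x+1"] by (simp add: stop_p1_def)
qed

lemma canonical_cases:
  assumes "canonical x b1 f1 b2 f2"
  obtains (white) "b1 = b2" "stop_p1 x b2" "best2 (x+b2) \<le> best1 (x-b2)" "b2 \<le> x"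
    | (black) "b2 = b1 + 1" "0 \<le> b1" "stop_p2 x b2" "\<not> (stop_p1 x b2 \<and> best2 (x+b2) \<le> best1 (x-b2))" "b1 \<le> x"
proof (cases "stop_p1 x b2 \<and> best2 (x+b2) \<le> best1 (x-b2)")
  case True
  have b: "b1 = b2" "b2 = last_bid x" using canonicalD(1,2)[OF assms] True by auto
  have "b2 \<le> x"
  proof (rule ccontr)
    assume "\<not> b2 \<le> x"
    \<comment> \<open>The gap between the value at \<open>-1\<close> and all payable ones must be
      strict here: matching a bid of \<open>x + 1\<close> would leave player 1 strictly worse off
      than losing.\<close>
    then have "b2 = x + 1" using b last_bid by auto
    then show False using bot_less[of "2*x+1"] best2_cases[of "2*x+1"] True x by (auto simp: algebra_simps)
  qed
  then show ?thesis using white True b by blast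
next
  case False
  have b: "b1 = b2 - 1" "b2 = last_bid x" using canonicalD(1,2)[OF assms] False by auto
  have "b2 \<noteq> 0" using b last_bid(1) stop_zero False by auto
  moreover have "stop_p2 x b2" using last_bid(1) False b by (auto simp: stop_p2_def)
  ultimately show ?thesis using black False b last_bid by auto
qed

lemma canonical_bounds:
  assumes "canonical x b1 f1 b2 f2"
  shows "0 \<le> b1" "b1 \<le> x" "0 \<le> b2" "b2 \<le> N - x"
  using assms last_bid canonicalD(1)[OF assms] by (cases rule: canonical_cases; simp)+

lemma not_stop_before:
  assumes "canonical x b1 f1 b2 f2" "0 \<le> m" "m < b2"
  shows "\<phi> (best1 (x-m)) < \<phi> (best2 (x+m+1))" "best2 (x+m) < best1 (x-m)"
  using last_bid_least[of m] assms(2,3) canonicalD(1)[OF assms(1)] unfolding stop_p1_def stop_p2_def by linarith+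

text \<open>If player 1 wins, \<open>stop_p1\<close> deters overbids and the tie rule deters
  underbids. If player 2 wins, \<open>stop_p2\<close> deters matching, and the minimality of the
  last bid makes losing at \<open>b1\<close> strictly worse for player 2 than paying
  \<open>b2\<close>.\<close>

lemma canonical_nash:
  assumes can: "canonical x b1 f1 b2 f2"
  shows "nash x b1 f1 b2 f2"
proof -
  note B = canonical_bounds[OF can] canonicalD(3-6)[OF can]
  from can show ?thesis
  proof (cases rule: canonical_cases)
    case white
    have "stage x b f b2 f2 \<le> stage x b1 f1 b2 f2" if "f \<in> {a, c}" for b f
      using best1_ge[OF that, of "x-b"] best1_mono[of "x-b" "x-b2"] white B by (auto simp: stage_def)
    moreover have "\<phi> (stage x b1 f1 b f) \<le> \<phi> (stage x b1 f1 b2 f2)" if "f \<in> {a, c}" for b f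
      using best2_ge[OF that, of "x+b"] best2_anti[of "x+b2+1" "x+b"] white B by (auto simp: stage_def stop_p1_def)
    ultimately show ?thesis using B unfolding nash_def by blast
  next
    case black
    have "stage x b f b2 f2 \<le> stage x b1 f1 b2 f2" if "f \<in> {a, c}" for b f
      using best1_ge[OF that, of "x-b"] best1_mono[of "x-b" "x-b2"] black B by (auto simp: stage_def stop_p2_def)
    moreover have "\<phi> (stage x b1 f1 b f) \<le> \<phi> (stage x b1 f1 b2 f2)" if "f \<in> {a, c}" for b f
      using best2_ge[OF that, of "x+b"] best2_anti[of "x+b2" "x+b"] not_stop_before(1)[OF can, of b1] black B by (auto simp: stage_def add.assoc)
    ultimately show ?thesis using B unfolding nash_def by blast
  qed
qed

text \<open>The winner can change her move while keeping her bid, so her move is optimal. Thus the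
  bids alone determine the result of an equilibrium.\<close>

lemma nash_stage:
  assumes ne: "nash x b1 f1 b2 f2"
  shows "stage x b1 f1 b2 f2 = (if b2 \<le> b1 then best1 (x-b1) else best2 (x+b2))"
proof (cases "b2 \<le> b1")
  case True
  obtain f where f: "f \<in> {a,c}" "f (x-b1) = best1 (x-b1)" by (rule best1_attained)
  have "stage x b1 f b2 f2 \<le> stage x b1 f1 b2 f2" using ne f(1) unfolding nash_def by blast
  then show ?thesis using True f best1_ge[of f1 "x-b1"] ne by (auto simp: stage_def nash_def)
next
  case False
  obtain f where f: "f \<in> {a,c}" "f (x+b2) = best2 (x+b2)" by (rule best2_attained)
  have "\<phi> (stage x b1 f1 b2 f) \<le> \<phi> (stage x b1 f1 b2 f2)" using ne f(1) unfolding nash_def by blast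
  then have "\<phi> (f2 (x+b2)) = \<phi> (best2 (x+b2))" using False f best2_ge[of f2 "x+b2"] ne by (auto simp: stage_def nash_def)
  then show ?thesis using False phi_eq by (auto simp: stage_def)
qed

lemma nash_stop_p1:
  assumes ne: "nash x b1 f1 b2 f2" and "b2 \<le> b1"
  shows "stop_p1 x b1"
proof (cases "b1 + 1 \<le> N - x")
  case True
  obtain f where f: "f \<in> {a,c}" "f (x+b1+1) = best2 (x+b1+1)" by (rule best2_attained)
  have "0 \<le> b1 + 1" using ne by (auto simp: nash_def)
  then have "\<phi> (stage x b1 f1 (b1+1) f) \<le> \<phi> (stage x b1 f1 b2 f2)" using ne f(1) True unfolding nash_def by blast
  then show ?thesis unfolding nash_stage[OF ne] stop_p1_def using f(2) assms(2) by (simp add: stage_def add.assoc)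
next
  case False
  then have "\<phi> (best2 (x+b1+1)) \<le> \<phi> (best2 (N+1))" by (intro best2_anti) auto
  also have "\<dots> \<le> \<phi> (best1 (x-b1))" using top_le[of "x-b1"] best1_cases[of "x-b1"] ne x by (auto simp: nash_def)
  finally show ?thesis by (simp add: stop_p1_def)
qed

lemma nash_stop_p2:
  assumes ne: "nash x b1 f1 b2 f2" and "b1 < b2"
  shows "stop_p2 x b2"
proof (cases "b2 \<le> x")
  case True
  obtain f where f: "f \<in> {a,c}" "f (x-b2) = best1 (x-b2)" by (rule best1_attained)
  have "stage x b2 f b2 f2 \<le> stage x b1 f1 b2 f2" using ne f(1) True unfolding nash_def by auto
  then show ?thesis unfolding nash_stage[OF ne] stop_p2_def using f(2) assms(2) by (simp add: stage_def)
next
  case False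
  then have "best1 (x-b2) \<le> best1 (-1)" by (intro best1_mono) auto
  also have "\<dots> \<le> best2 (x+b2)" using bot_le[of "x+b2"] best2_cases[of "x+b2"] ne x by (auto simp: nash_def)
  finally show ?thesis by (simp add: stop_p2_def)
qed

text \<open>Nothing forces \<open>f2\<close> to be best for the losing player 2; all that is known
  of it is that it deters player 1 from giving up the tie.\<close>

lemma nash_underbid:
  assumes ne: "nash x m f1 m f2" and "0 < m"
  shows "f2 (x+m) \<le> best1 (x-m)"
proof -
  have "stage x (m-1) f1 m f2 \<le> stage x m f1 m f2" using ne \<open>0 < m\<close> unfolding nash_def by auto
  then show ?thesis unfolding nash_stage[OF ne] by (simp add: stage_def)
qed

end

section \<open>Lowest bids among the equilibria of one round\<close>

lemma best2_cong: "a y = a y' \<Longrightarrow> c y = c y' \<Longrightarrow> best2 y = best2 y'"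
  by (simp add: best2_def)

text \<open>
  Shows that (m, m) is not an equilibrium when the auction stops at (m - 1, m): this is the only
  bid pair with maximum \<open>m\<close> that is lower in the order on bids.
\<close>

lemma no_white_win_at_conflict:
  assumes m: "0 < m" and R: "best2 (x+m) = c (x+m)" and gt: "best1 (x-m) < best2 (x+m)" and le: "a (x+m) \<le> best1 (x-m)"
    and stop: "stop_p1 x m" and prev: "\<phi> (best1 (x-m+1)) < \<phi> (best2 (x+m))" "best2 (x+m-1) < best1 (x-m+1)"
    and separate: "\<And>y. \<not> (cross y \<and> cross (y+1))"
  shows False
proof -
  have "best1 (x-m+1) \<noteq> c (x-m+1)" using prev(1) R c_anti[of "x-m+1" "x+m"] m by auto
  then have "best1 (x-m+1) = a (x-m+1)" using best1_cases by blast
  moreover have "a (x-m+1) \<le> a (x+m)" using m by (intro a_mono) auto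
  moreover have "best1 (x-m) \<le> best1 (x-m+1)" by (intro best1_mono) auto
  \<comment> \<open>The chain \<open>a (x-m+1) <= a (x+m) <= best1 (x-m) <= best1 (x-m+1)\<close>
    closes up, so all four values are equal.\<close>
  ultimately have X: "best1 (x-m) = best1 (x-m+1)" "a (x+m) = best1 (x-m)" using le by auto
  \<comment> \<open>Player 2's best outcome drops right after \<open>x + m\<close>; by separation it
    is constant right before, which contradicts the fact that the auction was still running one bid
    earlier.\<close>
  then have "best2 (x+m+1) \<noteq> best2 (x+m)" using stop prev(1) by (auto simp: stop_p1_def)
  then have "cross (x+m+1)" using best2_cong[of "x+m+1" "x+m"] by (auto simp: cross_def)
  then have "\<not> cross (x+m)" using separate by auto
  then have e: "best2 (x+m-1) = best2 (x+m)" using best2_cong[of "x+m-1" "x+m"] by (auto simp: cross_def)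
  show False using prev(2) e gt X by linarith
qed

lemma cross_swap: "two_chains.cross c a = cross"
  using two_chains.cross_def[OF swap] cross_def by (auto simp: fun_eq_iff)

lemma best1_swap: "two_chains.best1 c a = best1"
  using two_chains.best1_def[OF swap] best1_def by (auto simp: fun_eq_iff)

lemma best2_swap: "two_chains.best2 \<phi> c a = best2"
  using two_chains.best2_def[OF swap] best2_def phi_eq by (auto simp: fun_eq_iff)

lemma stop_swap: "two_chains.stop_p1 \<phi> c a = stop_p1" "two_chains.stop_p2 \<phi> c a = stop_p2"
  using two_chains.stop_p1_def[OF swap] stop_p1_def two_chains.stop_p2_def[OF swap] stop_p2_def best1_swap best2_swap by (auto simp: fun_eq_iff)

text \<open>Reflexive form of \<open>bids_gt\<close> on integer bids, with the first pair below the
  second.\<close>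

definition lower :: "int \<Rightarrow> int \<Rightarrow> int \<Rightarrow> int \<Rightarrow> bool" where
  "lower b1 b2 b1' b2' \<longleftrightarrow> max b1 b2 < max b1' b2' \<or> max b1 b2 = max b1' b2' \<and> (min b1' b2' < min b1 b2) \<or> 
     b1 = b1' \<and> b2 = b2' \<or> (b1 < b2 \<and> b1' = b2 \<and> b2' = b1)"

text \<open>The larger bid of any equilibrium satisfies a stop condition, hence is at least
  \<open>last_bid x\<close>. Among pairs with maximum \<open>m\<close>, \<open>(m, m)\<close> is
  lowest and \<open>(m - 1, m)\<close> is next, so only a possible \<open>(m, m)\<close> against a
  win of player 2 has to be refuted.\<close>

lemma nash_above_canonical:
  assumes x: "0 \<le> x" "x \<le> N" and can: "canonical x b1 f1 b2 f2" and ne: "nash x b1' g1 b2' g2"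
    and separate: "\<And>y. \<not> (cross y \<and> cross (y+1))"
  shows "lower b1 b2 b1' b2'"
proof -
  let ?m = "max b1' b2'"
  have "0 \<le> ?m" using ne by (auto simp: nash_def)
  moreover have "stop_p1 x ?m \<or> stop_p2 x ?m"
    using nash_stop_p1[OF x ne] nash_stop_p2[OF x ne] by (cases "b2' \<le> b1'") (auto simp: max_absorb1 max_absorb2)
  ultimately have ge: "b2 \<le> ?m" using last_bid_least[OF x] canonicalD(1)[OF can] by auto
  show ?thesis using x can
  proof (cases rule: canonical_cases)
    case white
    then show ?thesis using ge by (auto simp: lower_def)
  next
    case black
    have "\<not> (b1' = b2 \<and> b2' = b2)"
    proof
      assume eq: "b1' = b2 \<and> b2' = b2"
      then have ne': "nash x b2 g1 b2 g2" using ne by simp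
      have m: "0 < b2" using black by simp
      have st: "stop_p1 x b2" using nash_stop_p1[OF x ne'] by simp
      then have gt: "best1 (x-b2) < best2 (x+b2)" using black by auto
      have le: "g2 (x+b2) \<le> best1 (x-b2)" using nash_underbid[OF x ne' m] .
      have e: "x - (b2 - 1) = x - b2 + 1" "x + (b2 - 1) = x + b2 - 1" "x + (b2 - 1) + 1 = x + b2" by auto
      have prev: "\<phi> (best1 (x-b2+1)) < \<phi> (best2 (x+b2))" "best2 (x+b2-1) < best1 (x-b2+1)"
        using not_stop_before[OF x can, of "b2-1"] m unfolding e by auto
      from best2_cases[of "x+b2"] show False
      proof
        assume W: "best2 (x+b2) = c (x+b2)"
        then have "a (x+b2) \<le> best1 (x-b2)" using le gt ne' by (auto simp: nash_def)
        then show False using no_white_win_at_conflict[OF m W gt _ st prev separate] by blast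
      next
        assume W: "best2 (x+b2) = a (x+b2)"
        then have "c (x+b2) \<le> best1 (x-b2)" using le gt ne' by (auto simp: nash_def)
        then show False
          using two_chains.no_white_win_at_conflict[OF swap m, unfolded best1_swap best2_swap cross_swap stop_swap, OF W gt _ st prev separate]
          by blast
      qed
    qed
    then show ?thesis using ge black by (auto simp: lower_def)
  qed
qed

text \<open>Since the auction was still running one bid earlier, player 1 was after \<open>a\<close>
  and player 2 after \<open>c\<close>, so the pair \<open>(?l, ?r)\<close> is live. Testing
  \<open>(?l, x+m)\<close> and then \<open>(x-m, x+m)\<close>, the first failure of liveness gives
  the stop, and the way it fails gives \<open>z\<close>.\<close>

lemma auction_merged:
  assumes m: "0 < m" and A: "best1 (x-m+1) = a (x-m+1)"
    and prev: "\<phi> (best1 (x-m+1)) < \<phi> (best2 (x+m))" "best2 (x+m-1) < best1 (x-m+1)"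
    and z: "stop_p2 x m \<and> z = best2 (x+m) \<or> stop_p1 x m \<and> best2 (x+m) \<le> z \<and> z = best1 (x-m)"
  shows "merged \<phi> a c (2*x+1) z"
proof -
  let ?l = "x-m+1" and ?r = "x+m-1"
  have r: "?r + 1 = x + m" "x + m + 1 = ?r + 2" "x - m = ?l - 1" "?l + ?r = 2*x" by auto
  have lr: "?l \<le> ?r" using m by simp
  have c1: "best2 (x+m) = c (x+m)" using prev(1) A a_anti[of ?l "x+m"] best2_cases[of "x+m"] m by force
  have ca: "c ?r < a ?l" using prev(2) A a_mono[of ?l ?r] lr best2_cases[of ?r] by auto
  have l0: "live \<phi> a c ?l ?r" using lr ca c_anti[of ?r "x+m"] prev(1) A c1 by (auto simp: live_def)
  have right: "merged \<phi> a c (2*x+1) z" if "right_stop \<phi> a c ?l ?r z"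
    using that r(4) unfolding merged_def half_result_def by (metis add_diff_cancel_right')
  have left: "merged \<phi> a c (2*x+1) z" if "left_stop \<phi> a c ?l (x+m) z"
    using that unfolding merged_def half_result_def by (metis add.commute add.left_commute mult_2 add_diff_cancel diff_add_cancel uminus_add_conv_diff)
  have cc: "c (x-m) \<le> c (x+m)" using m by (intro c_mono) auto
  have W: "best1 (x-m) \<le> a ?l" using best1_mono[of "x-m" ?l] A by auto
  show ?thesis
  proof (cases "a ?l \<le> c (x+m)")
    case True
    have "z = c (x+m)" using z W True c1 by auto
    then have "right_stop \<phi> a c ?l ?r z" using l0 True prev(1) A c1 by (auto simp: right_stop_def)
    then show ?thesis by (rule right)
  next
    case False
    then have l1: "live \<phi> a c ?l (x+m)" using lr prev(1) A c1 by (auto simp: live_def)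
    show ?thesis
    proof (cases "a (x-m) \<le> c (x+m)")
      case True
      then have "z = c (x+m)" using z cc c1 best1_cases[of "x-m"] by auto
      then have "left_stop \<phi> a c ?l (x+m) z" using l1 True unfolding left_stop_def r(3)[symmetric] by simp
      then show ?thesis by (rule left)
    next
      case gt: False
      \<comment> \<open>Player 1 still gains from matching, so only \<open>stop_p1\<close> can have
        ended the auction.\<close>
      then have z1: "z = a (x-m)" "stop_p1 x m" using z cc c1 best1_ge[of a "x-m"] best1_cases[of "x-m"] by (auto simp: stop_p2_def)
      show ?thesis
      proof (cases "\<phi> (c (x+m)) \<le> \<phi> (a (x-m))")
        case True
        then have "left_stop \<phi> a c ?l (x+m) z" using l1 gt z1 unfolding left_stop_def r(3)[symmetric] by simp
        then show ?thesis by (rule left)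
      next
        case False
        then have l2: "live \<phi> a c (x-m) (x+m)" using gt m by (auto simp: live_def)
        have "\<phi> (c (x+m+1)) \<le> \<phi> (a (x-m))" 
          using z1 z gt cc best2_ge[of c "x+m+1"] best1_cases[of "x-m"] best1_ge[of a "x-m"] by (auto simp: stop_p1_def)
        then have "right_stop \<phi> a c (x-m) (x+m) z" using l2 z1 by (simp add: right_stop_def)
        then show ?thesis unfolding merged_def half_result_def
          by (metis add_diff_cancel_right' diff_add_cancel add.commute add_diff_eq mult_2)
      qed
    qed
  qed
qed

lemma canonical_merged:
  assumes x: "0 \<le> x" "x \<le> N" and can: "canonical x b1 f1 b2 f2"
  shows "merged \<phi> a c (2*x+1) (stage x b1 f1 b2 f2)"
proof (cases "0 < b2")
  case True
  let ?z = "stage x b1 f1 b2 f2"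
  have z: "stop_p2 x b2 \<and> ?z = best2 (x+b2) \<or> stop_p1 x b2 \<and> best2 (x+b2) \<le> ?z \<and> ?z = best1 (x-b2)"
    using x can
  proof (cases rule: canonical_cases)
    case white
    then show ?thesis using canonicalD[OF can] by (simp add: stage_def)
  next
    case black
    then show ?thesis using canonicalD[OF can] by (simp add: stage_def)
  qed
  have e: "x - (b2 - 1) = x - b2 + 1" "x + (b2 - 1) = x + b2 - 1" "x + (b2 - 1) + 1 = x + b2" by auto
  have prev: "\<phi> (best1 (x-b2+1)) < \<phi> (best2 (x+b2))" "best2 (x+b2-1) < best1 (x-b2+1)"
    using not_stop_before[OF x can, of "b2-1"] True unfolding e by auto
  from best1_cases[of "x-b2+1"] show ?thesis
  proof
    assume "best1 (x-b2+1) = a (x-b2+1)"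
    from auction_merged[OF True this prev z] show ?thesis .
  next
    assume "best1 (x-b2+1) = c (x-b2+1)"
    from two_chains.auction_merged[OF swap True, unfolded best1_swap best2_swap stop_swap, OF this prev z] 
    show ?thesis unfolding merged_swap[of \<phi> c a] .
  qed
next
  case False
  \<comment> \<open>At bids \<open>(0, 0)\<close> there is no earlier bid, so
    \<open>auction_merged\<close> does not apply; the result is an agreement or a stop at the
    diagonal pair.\<close>
  then have b: "b2 = 0" "b1 = 0" "stop_p1 x 0"
    using canonical_bounds[OF x can] canonical_cases[OF x can] by force+
  then have z: "stage x b1 f1 b2 f2 = best1 x" "\<phi> (best2 (x+1)) \<le> \<phi> (best1 x)" using canonicalD[OF can] by (auto simp: stage_def stop_p1_def)
  have key: "half_result \<phi> a c (2*x+1) (best1 x)" if "two_chains \<phi> N a c" "c x \<le> a x" "\<phi> (c (x+1)) \<le> \<phi> (a x)" "best1 x = a x"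
    for a c
  proof (cases "\<phi> (c x) \<le> \<phi> (a x)")
    case True
    then have "agree \<phi> a c x (best1 x)" using that by (auto simp: agree_def)
    then show ?thesis by (simp add: half_result_def)
  next
    case False
    then have "c x < a x" using that(2) by (cases "c x = a x") auto
    then have "right_stop \<phi> a c x x (best1 x)" using that(3,4) False
      by (simp add: right_stop_def live_def)
    moreover have "x + x = (2*x+1) - 1" by simp
    ultimately show ?thesis unfolding half_result_def by blast
  qed
  from best1_cases[of x] have "half_result \<phi> a c (2*x+1) (best1 x) \<or> half_result \<phi> c a (2*x+1) (best1 x)"
  proof
    assume W: "best1 x = a x"
    have "\<phi> (c (x+1)) \<le> \<phi> (a x)" using z best2_ge[of c "x+1"] W by auto
    then show ?thesis using key[OF two_chains_axioms] W best1_ge[of c x] by auto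
  next
    assume W: "best1 x = c x"
    have "\<phi> (a (x+1)) \<le> \<phi> (c x)" using z best2_ge[of a "x+1"] W by auto
    then show ?thesis using key[OF swap] W best1_ge[of a x] by auto
  qed
  then show ?thesis using z by (simp add: merged_def)
qed

text \<open>Of two different stops on one walk, the earlier is followed by a pair that is not live
  although it lies inside the live pair of the later.\<close>

lemma half_unique:
  assumes "half_result \<phi> a c i z" "half_result \<phi> a c i z'"
  shows "z = z'"
proof -
  have dj: False if "agree \<phi> a c (i div 2) w" "left_stop \<phi> a c l r w' \<and> l + r = i \<or> right_stop \<phi> a c l r w' \<and> l + r = i - 1" for w w' l r
  proof -
    have "live \<phi> a c l r" using that(2) by (auto simp: left_stop_def right_stop_def)
    moreover have "l \<le> r" "l + r = i \<or> l + r = i - 1" using that(2) \<open>live \<phi> a c l r\<close> by (auto simp: live_def)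
    moreover from this have "l \<le> i div 2 \<and> i div 2 \<le> r" by presburger
    ultimately show False using live_mono[of l r "i div 2" "i div 2"] agree_not_live that(1) by blast
  qed
  have ll: "w = w'" if "left_stop \<phi> a c l r w" "l + r = i" "left_stop \<phi> a c l' r' w'" "l' + r' = i" for w w' l r l' r'
  proof -
    have lv: "live \<phi> a c l r" "live \<phi> a c l' r'" using that by (auto simp: left_stop_def)
    have "l = l'"
      using live_mono[OF lv(1), of "l'-1" r'] live_mono[OF lv(2), of "l-1" r] left_not_live[OF that(1)] left_not_live[OF that(3)]
       lv that(2,4) unfolding live_def by (smt (verit))
    moreover have "r = r'" using calculation that by auto
    ultimately show ?thesis using that(1,3) by (auto simp: left_stop_def)
  qed
  have rr: "w = w'" if "right_stop \<phi> a c l r w" "l + r = i - 1" "right_stop \<phi> a c l' r' w'" "l' + r' = i - 1" for w w' l r l' r'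
  proof -
    have lv: "live \<phi> a c l r" "live \<phi> a c l' r'" using that by (auto simp: right_stop_def)
    have "l = l'"
      using live_mono[OF lv(1), of "l'" "r'+1"] live_mono[OF lv(2), of "l" "r+1"] right_not_live[OF that(1)] right_not_live[OF that(3)]
       lv that(2,4) unfolding live_def by (smt (verit))
    moreover have "r = r'" using calculation that by auto
    ultimately show ?thesis using that(1,3) by (auto simp: right_stop_def)
  qed
  have lr: False if "left_stop \<phi> a c l r w" "l + r = i" "right_stop \<phi> a c l' r' w'" "l' + r' = i - 1" for w w' l r l' r'
  proof -
    have lv: "live \<phi> a c l r" "live \<phi> a c l' r'" using that by (auto simp: right_stop_def left_stop_def)
    have "l \<le> r" "l' \<le> r'" using lv by (auto simp: live_def)
    then show False
      using live_mono[OF lv(1), of "l'" "r'+1"] live_mono[OF lv(2), of "l-1" r] left_not_live[OF that(1)] right_not_live[OF that(3)]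
       that(2,4) by (smt (verit))
  qed
  have second: "agree \<phi> a c (i div 2) z' \<or> (\<exists>l r. l + r = i \<and> left_stop \<phi> a c l r z') \<or>
      (\<exists>l r. l + r = i - 1 \<and> right_stop \<phi> a c l r z')" using assms(2) by (simp add: half_result_def)
  from assms(1)[unfolded half_result_def] show ?thesis
  proof (elim disjE exE conjE)
    assume "agree \<phi> a c (i div 2) z"
    then show ?thesis using second dj by (auto simp: agree_def)
  next
    fix l r assume "l + r = i" "left_stop \<phi> a c l r z"
    then show ?thesis using second dj ll lr by blast
  next
    fix l r assume "l + r = i - 1" "right_stop \<phi> a c l r z"
    then show ?thesis using second dj rr lr by blast
  qed
qed

lemma half_result_live:
  assumes "half_result \<phi> a c i z"
  shows "agree \<phi> a c (i div 2) z \<or> live \<phi> a c (i div 2) (i div 2)"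
proof -
  have "live \<phi> a c (i div 2) (i div 2)" if "live \<phi> a c l r" "l + r = i \<or> l + r = i - 1" for l r
  proof -
    have "l \<le> r" using that by (auto simp: live_def)
    then have "l \<le> i div 2" "i div 2 \<le> r" using that(2) by presburger+
    then show ?thesis using live_mono[OF that(1)] by blast
  qed
  then show ?thesis using assms unfolding half_result_def left_stop_def right_stop_def by blast
qed

lemma merged_unique:
  assumes "merged \<phi> a c i z" "merged \<phi> a c i z'"
  shows "z = z'"
proof -
  interpret sw: two_chains \<phi> N c a by (rule swap)
  have "w = w'" if "half_result \<phi> a c i w" "half_result \<phi> c a i w'" for w w'
    using half_result_live[OF that(1)] sw.half_result_live[OF that(2)]
    by (auto simp: live_def agree_def)
  then show ?thesis using assms half_unique sw.half_unique unfolding merged_def by blast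
qed

end

lemma int_step_mono:
  assumes "\<And>y::int. (f y :: 'b::order) \<le> f (y+1)" "x \<le> y" shows "f x \<le> f y"
proof -
  have "f x \<le> f (x + int n)" for n
  proof (induction n)
    case (Suc n)
    have "f (x + int n) \<le> f (x + int (Suc n))" using assms(1)[of "x + int n"] by (simp add: algebra_simps)
    with Suc show ?case by (rule order_trans)
  qed simp
  from this[of "nat (y - x)"] show ?thesis using assms(2) by simp
qed

section \<open>Outcome functions of states\<close>

text \<open>\<open>-1\<close> is below all ranks of player 1 and \<open>K\<close> above them, while
  \<phi> reverses them for player 2: each is the worst outcome of one player and the best of the
  other.\<close>

locale ranked_outcomes =
  fixes \<phi> :: "int \<Rightarrow> real" and K N :: int and U :: "int set"
  assumes inj: "inj \<phi>" and Npos: "0 < N" and U: "U \<subseteq> {0..<K}" "\<And>u. u \<in> U \<Longrightarrow> 0 \<le> \<phi> u \<and> \<phi> u < K"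
    and K: "\<phi> (-1) = K" "\<phi> K = -1" and K0: "0 \<le> K"
begin

definition chain :: "(int \<Rightarrow> int) \<Rightarrow> bool" where
  "chain f \<longleftrightarrow> (\<forall>y<0. f y = -1) \<and> (\<forall>y>N. f y = K) \<and> (\<forall>y. 0 \<le> y \<and> y \<le> N \<longrightarrow> f y \<in> U) \<and>
     (\<forall>x y. x \<le> y \<longrightarrow> f x \<le> f y \<and> \<phi> (f y) \<le> \<phi> (f x))"

text \<open>The last budget cell is closed, so \<open>N\<close> is not a boundary although \<open>L\<close> divides it.\<close>

definition boundary :: "int \<Rightarrow> int \<Rightarrow> bool" where
  "boundary L y \<longleftrightarrow> L dvd y \<and> y < N \<or> y = N + 1"

text \<open>Invariant of the backward induction, with \<open>S\<close> the ranks of the terminals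
  below a state. Coverage is by weak domination rather than attainment, because a merge may discard
  dominated ranks; for efficient ranks injectivity of \<phi> restores attainment.\<close>

definition good :: "int \<Rightarrow> int set \<Rightarrow> (int \<Rightarrow> int) \<Rightarrow> bool" where
  "good L S f \<longleftrightarrow> chain f \<and> (\<forall>y. f (y-1) \<noteq> f y \<longrightarrow> boundary L y) \<and>
     (\<forall>x\<in>{0..N}. f x \<in> S) \<and>
     (\<forall>t\<in>S. \<exists>x\<in>{0..N}. t \<le> f x \<and> \<phi> t \<le> \<phi> (f x)) \<and>
     (\<forall>t\<in>S. \<forall>x\<in>{0..N}. \<not> (f x < t \<and> \<phi> (f x) < \<phi> t))"

lemma chainD:
  assumes "chain f"
  shows "y < 0 \<Longrightarrow> f y = -1" "N < y \<Longrightarrow> f y = K" "0 \<le> y \<Longrightarrow> y \<le> N \<Longrightarrow> f y \<in> U"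
    "x \<le> y \<Longrightarrow> f x \<le> f y" "x \<le> y \<Longrightarrow> \<phi> (f y) \<le> \<phi> (f x)"
  using assms unfolding chain_def by blast+

lemma two_chainsI:
  assumes a: "chain a" and c: "chain c" shows "two_chains \<phi> N a c"
proof
  have N0: "0 \<le> N" using Npos by simp
  show "inj \<phi>" "0 \<le> N" using inj N0 by auto
  show "a (-1) = c (-1)" "a (N+1) = c (N+1)" using chainD[OF a] chainD[OF c] by auto
  have "a 0 \<in> U" "c 0 \<in> U" "a N \<in> U" "c N \<in> U" using chainD(3)[OF a] chainD(3)[OF c] N0 by auto
  then show "a (-1) < a 0" "c (-1) < c 0" "\<phi> (a (N+1)) < \<phi> (a N)" "\<phi> (c (N+1)) < \<phi> (c N)"
    using chainD(1)[OF a, of "-1"] chainD(1)[OF c, of "-1"] chainD(2)[OF a, of "N+1"] chainD(2)[OF c, of "N+1"] U K by force+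
qed (use chainD(4,5)[OF a] chainD(4,5)[OF c] in auto)

text \<open>Two multiples of the even \<open>L\<close> have an even sum, so \<open>y\<close> is
  their midpoint. The step at \<open>N + 1\<close> behaves like a multiple of \<open>L\<close> at
  \<open>N\<close>: the sum is then odd and \<open>y\<close> is the midpoint of \<open>l\<close> and
  \<open>N\<close>.\<close>

lemma boundary_half:
  assumes "L = 2 * M" "L dvd N" "0 < M" "boundary L l" "boundary L r" "l \<le> r" "l + r = 2*y \<or> l + r = 2*y+1" "y \<le> N"
  shows "boundary M y"
proof (cases "r = N + 1")
  case True
  then have "l \<noteq> N + 1" using assms(7,8) by presburger
  then have l: "L dvd l" "l < N" using assms(4) by (auto simp: boundary_def)
  then have d: "L dvd l + N" using assms(2) by simp
  then have "even (l + N)" using assms(1) by (meson dvd_mult_left)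
  then have "l + N = 2 * y" using True assms(7) by presburger
  then show ?thesis using d assms(1) l by (auto simp: boundary_def)
next
  case False
  then have r: "L dvd r" "r < N" "L dvd l" using assms(4,5,6) by (auto simp: boundary_def)
  then have d: "L dvd l + r" by simp
  then have "even (l + r)" using assms(1) by (meson dvd_mult_left)
  then have "l + r = 2 * y" using assms(7) by presburger
  then show ?thesis using d assms(1,6) r by (auto simp: boundary_def)
qed

lemma merge_good:
  assumes L: "L = 2 * M" "L dvd N" "0 < M" and a: "good L S a" and c: "good L S' c"
    and f: "\<And>y. y < 0 \<Longrightarrow> f y = -1" "\<And>y. N < y \<Longrightarrow> f y = K" "\<And>x. 0 \<le> x \<Longrightarrow> x \<le> N \<Longrightarrow> merged \<phi> a c (2*x+1) (f x)"
      "\<And>x. 0 \<le> x \<Longrightarrow> x \<le> N \<Longrightarrow> \<exists>y\<in>{0..N}. f x = a y \<or> f x = c y"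
  shows "good M (S \<union> S') f"
proof -
  have ca: "chain a" and cc: "chain c" using a c by (auto simp: good_def)
  interpret two_chains \<phi> N a c using ca cc by (rule two_chainsI)
  have fU: "f x \<in> U" if "0 \<le> x" "x \<le> N" for x
    using f(4)[OF that] chainD(3)[OF ca] chainD(3)[OF cc] by fastforce
  have cross: "boundary L y" if "cross y" for y
    using that a c unfolding cross_def good_def by blast
  have step: "f y \<le> f (y+1) \<and> (f y \<noteq> f (y+1) \<longrightarrow> boundary M (y+1))" if y: "0 \<le> y" "y < N" for y
  proof -
    \<comment> \<open>From budget \<open>y\<close> to \<open>y + 1\<close> the index passes through
      \<open>2 * y + 2\<close>, which is no budget; a jump at either of the two moves has its
      rounded-down midpoint at \<open>y + 1\<close>.\<close>
    obtain w where w: "merged \<phi> a c (2*y+2) w" using merged_exists[of "2*y+2"] y by auto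
    have m: "merged \<phi> a c (2*y+1) (f y)" "merged \<phi> a c (2*y+3) (f (y+1))" using f(3)[of y] f(3)[of "y+1"] y by (auto simp: algebra_simps)
    have s: "f y \<le> w \<and> (f y \<noteq> w \<longrightarrow> jump (2*y+2))" "w \<le> f (y+1) \<and> (w \<noteq> f (y+1) \<longrightarrow> jump (2*y+3))"
      using merged_step[OF m(1), of w] merged_step[OF w, of "f (y+1)"] m(2) w by (auto simp: algebra_simps)
    have "boundary M (y+1)" if "jump (2*y+2) \<or> jump (2*y+3)"
    proof -
      obtain l r where lr: "l + r = 2*(y+1) \<or> l + r = 2*(y+1)+1" "l \<le> r" "cross l" "cross r"
        using \<open>jump (2*y+2) \<or> jump (2*y+3)\<close> unfolding jump_def by (auto simp: algebra_simps)
      show ?thesis using boundary_half[OF L cross[OF lr(3)] cross[OF lr(4)] lr(2,1)] y by auto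
    qed
    then show ?thesis using s by force
  qed
  have pareto: "\<not> (f x < a p \<and> \<phi> (f x) < \<phi> (a p))" "\<not> (f x < c p \<and> \<phi> (f x) < \<phi> (c p))" if "0 \<le> x" "x \<le> N" for x p
    using merged_pareto[OF f(3)[OF that]] by auto
  have up: "f y \<le> f (y+1) \<and> \<phi> (f (y+1)) \<le> \<phi> (f y) \<and> (f y \<noteq> f (y+1) \<longrightarrow> boundary M (y+1))" for y
  proof -
    consider "y < -1" | "y = -1" | "0 \<le> y" "y < N" | "y = N" | "N < y" by linarith
    then show ?thesis
    proof cases
      case 1 then show ?thesis using f(1) by simp
    next
      case 2
      have "f (-1) = -1" "f 0 \<in> U" using f(1) fU[of 0] Npos by auto
      then have "f (-1) < f 0" "\<phi> (f 0) \<le> \<phi> (f (-1))" using U K by force+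
      then show ?thesis using 2 Npos by (simp add: boundary_def)
    next
      case 3
      obtain p where "f (y+1) = a p \<or> f (y+1) = c p" using f(4)[of "y+1"] 3 by auto
      then have "f y < f (y+1) \<longrightarrow> \<not> \<phi> (f y) < \<phi> (f (y+1))" using pareto[of y p] 3 by auto
      then show ?thesis using step[OF 3] by (cases "f y = f (y+1)") auto
    next
      case 4
      have "f (N+1) = K" "f N \<in> U" using f(2) fU[of N] Npos by auto
      then have "f N < f (N+1)" "\<phi> (f (N+1)) \<le> \<phi> (f N)" using U K by force+
      then show ?thesis using 4 by (simp add: boundary_def)
    next
      case 5 then show ?thesis using f(2) by simp
    qed
  qed
  \<comment> \<open>\<open>N\<close> and \<open>N + 1\<close> would be adjacent, but
    \<open>N\<close> is not a boundary; all other boundaries are multiples of the even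
    \<open>L\<close>.\<close>
  have separate: "\<not> (cross y \<and> cross (y+1))" for y
  proof
    assume "cross y \<and> cross (y+1)"
    then have "boundary L y" "boundary L (y+1)" using cross by auto
    then have "L dvd y" "L dvd y + 1" by (auto simp: boundary_def)
    then have "L dvd 1" by (simp add: dvd_add_right_iff)
    then show False using L by auto
  qed
  have ends: "cross 0" "cross (N+1)" using bot top by (auto simp: cross_def)
  interpret sw: two_chains \<phi> N c a by (rule swap)
  have attained: "\<exists>x\<in>{0..N}. f x = c q" if "q \<in> {0..N}" "\<And>p. \<not> (c q < a p \<and> \<phi> (c q) < \<phi> (a p))" for q
    using undominated_attained[of q] that separate ends merged_unique f(3) by (metis atLeastAtMost_iff)
  have attained': "\<exists>x\<in>{0..N}. f x = a q" if "q \<in> {0..N}" "\<And>p. \<not> (a q < c p \<and> \<phi> (a q) < \<phi> (c p))" for q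
    using sw.undominated_attained[of q] that separate ends merged_unique f(3) unfolding cross_swap merged_swap[of \<phi> c a]
    by (metis atLeastAtMost_iff)
  \<comment> \<open>If \<open>g q\<close> is dominated by some \<open>h p\<close>, then
    \<open>h p\<close> covers \<open>t\<close> as well and is itself undominated by
    \<open>g\<close>: up to \<open>q\<close>, \<open>g\<close> offers player 1 no more than
    \<open>g q\<close>, and from \<open>q\<close> on it offers player 2 no more.\<close>
  have cover: "\<exists>x\<in>{0..N}. t \<le> f x \<and> \<phi> t \<le> \<phi> (f x)"
    if q: "q \<in> {0..N}" and t: "t \<le> g q" "\<phi> t \<le> \<phi> (g q)" and cg: "chain g" "chain h"
      and att: "\<And>q. q \<in> {0..N} \<Longrightarrow> (\<And>p. \<not> (g q < h p \<and> \<phi> (g q) < \<phi> (h p))) \<Longrightarrow> \<exists>x\<in>{0..N}. f x = g q"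
      and att': "\<And>q. q \<in> {0..N} \<Longrightarrow> (\<And>p. \<not> (h q < g p \<and> \<phi> (h q) < \<phi> (g p))) \<Longrightarrow> \<exists>x\<in>{0..N}. f x = h q"
    for t q g h
  proof (cases "\<exists>p. g q < h p \<and> \<phi> (g q) < \<phi> (h p)")
    case True
    then obtain p where p: "g q < h p" "\<phi> (g q) < \<phi> (h p)" by blast
    \<comment> \<open>A dominating value cannot come from outside the budget range, as the values
      there are worst for one of the players.\<close>
    have "g q \<in> U" using chainD(3)[OF cg(1)] q by auto
    then have "0 \<le> g q" "0 \<le> \<phi> (g q)" using U by force+
    then have "h p \<noteq> -1" "h p \<noteq> K" using p K by auto
    then have P: "p \<in> {0..N}" using chainD(1,2)[OF cg(2), of p] by force
    have "\<not> (h p < g p' \<and> \<phi> (h p) < \<phi> (g p'))" for p'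
      using p chainD(4)[OF cg(1), of p' q] chainD(5)[OF cg(1), of q p'] by force
    then obtain x where "x \<in> {0..N}" "f x = h p" using att'[OF P] by blast
    then show ?thesis using p t by force
  next
    case False
    then show ?thesis using att[OF q] t by force
  qed
  have "chain f"
    unfolding chain_def using f(1,2) fU int_step_mono[of f] int_step_mono[of "\<lambda>y. - \<phi> (f y)"] up by auto
  moreover have "boundary M y" if "f (y-1) \<noteq> f y" for y using up[of "y-1"] that by auto
  moreover have "f x \<in> S \<union> S'" if "x \<in> {0..N}" for x using f(4)[of x] that a c by (auto simp: good_def)
  moreover have "\<exists>x\<in>{0..N}. t \<le> f x \<and> \<phi> t \<le> \<phi> (f x)" if "t \<in> S \<union> S'" for t
    using that
  proof
    assume "t \<in> S"
    then obtain q where "q \<in> {0..N}" "t \<le> a q" "\<phi> t \<le> \<phi> (a q)" using a by (auto simp: good_def)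
    then show ?thesis using cover[of q t a c] ca cc attained attained' by blast
  next
    assume "t \<in> S'"
    then obtain q where "q \<in> {0..N}" "t \<le> c q" "\<phi> t \<le> \<phi> (c q)" using c by (auto simp: good_def)
    then show ?thesis using cover[of q t c a] ca cc attained attained' by blast
  qed
  moreover have "\<not> (f x < t \<and> \<phi> (f x) < \<phi> t)" if "t \<in> S \<union> S'" "x \<in> {0..N}" for t x
  proof
    assume d: "f x < t \<and> \<phi> (f x) < \<phi> t"
    have "(\<exists>p. t \<le> a p \<and> \<phi> t \<le> \<phi> (a p)) \<or> (\<exists>p. t \<le> c p \<and> \<phi> t \<le> \<phi> (c p))" using that(1) a c by (auto simp: good_def)
    then show False using pareto[of x] that(2) d by (metis atLeastAtMost_iff order_less_le_trans)
  qed
  ultimately show ?thesis unfolding good_def by blast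
qed

definition leaf :: "int \<Rightarrow> int \<Rightarrow> int" where
  "leaf u y = (if y < 0 then -1 else if N < y then K else u)"

lemma leaf_good:
  assumes "u \<in> U" shows "good L {u} (leaf u)"
proof -
  have u: "0 \<le> u" "u < K" "0 \<le> \<phi> u" "\<phi> u < K" using assms U by force+
  have "chain (leaf u)" unfolding chain_def using u assms K Npos by (auto simp: leaf_def)
  moreover have "boundary L y" if "leaf u (y-1) \<noteq> leaf u y" for y
    using that Npos by (cases "y = 0"; cases "y = N + 1") (auto simp: leaf_def boundary_def split: if_splits)
  moreover have "leaf u x = u" if "x \<in> {0..N}" for x using that by (simp add: leaf_def)
  moreover have "(0::int) \<in> {0..N}" using Npos by simp
  ultimately show ?thesis unfolding good_def by force
qed

lemma good_dvd: "good L S f \<Longrightarrow> M dvd L \<Longrightarrow> good M S f"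
  unfolding good_def boundary_def by (meson dvd_trans)

end

section \<open>Play and equilibrium\<close>

locale bidding_game =
  fixes G :: "'s game" and \<epsilon> :: real and R k :: nat
  assumes game: "game_structure G" and bin: "binary G" and R: "0 < R" and eps: "\<epsilon> = 1 / (real R * 2 ^ k)"
    and hk: "height G = k"
begin

definition N :: int where "N = int R * 2 ^ k"

lemma N_pos: "0 < N" using R by (simp add: N_def)
lemma eps_pos: "0 < \<epsilon>" using R by (simp add: eps)
lemma N_eps: "real_of_int N * \<epsilon> = 1" using R by (simp add: eps N_def)

lemma scale_le: "real_of_int x * \<epsilon> \<le> real_of_int y * \<epsilon> \<longleftrightarrow> x \<le> y"
  using eps_pos by simp
lemma scale_eq: "real_of_int x * \<epsilon> = real_of_int y * \<epsilon> \<longleftrightarrow> x = y"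
  using eps_pos by simp
lemma scale_le1: "real_of_int x * \<epsilon> \<le> 1 \<longleftrightarrow> x \<le> N"
  using scale_le[of x N] N_eps by simp

lemma budgets_iff: "B \<in> budgets \<epsilon> \<longleftrightarrow> (\<exists>x::int. 0 \<le> x \<and> x \<le> N \<and> B = real_of_int x * \<epsilon>)"
proof
  assume "B \<in> budgets \<epsilon>"
  then obtain n :: nat where n: "B = real n * \<epsilon>" "B \<le> 1" by (auto simp: budgets_def)
  then have "int n \<le> N" using scale_le1[of "int n"] by simp
  then show "\<exists>x::int. 0 \<le> x \<and> x \<le> N \<and> B = real_of_int x * \<epsilon>" using n by (intro exI[of _ "int n"]) auto
next
  assume "\<exists>x::int. 0 \<le> x \<and> x \<le> N \<and> B = real_of_int x * \<epsilon>"
  then obtain x :: int where x: "0 \<le> x" "x \<le> N" "B = real_of_int x * \<epsilon>" by blast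
  then show "B \<in> budgets \<epsilon>" unfolding budgets_def using scale_le1[of x] by (auto intro!: exI[of _ "nat x"])
qed

lemma grid: "0 \<le> x \<Longrightarrow> x \<le> N \<Longrightarrow> real_of_int x * \<epsilon> \<in> budgets \<epsilon>"
  using budgets_iff by blast

lemma fin: "finite (states G)" and term_sub: "terminals G \<subseteq> states G"
  and fin_term: "finite (terminals G)" and init_state: "init G \<in> states G"
  using game by (auto simp: game_structure_def intro: finite_subset)

lemma reach: "s \<in> states G \<Longrightarrow> (init G, s) \<in> (edges G)\<^sup>*"
  using game by (auto simp: game_structure_def)

lemma nonterm: "s \<in> nonterminals G \<longleftrightarrow> s \<in> states G \<and> s \<notin> terminals G"
  by (auto simp: nonterminals_def)

lemma moves_state: "s \<in> nonterminals G \<Longrightarrow> d \<in> moves G s \<Longrightarrow> d \<in> states G"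
  using game by (auto simp: game_structure_def)

lemma edge: "s \<in> nonterminals G \<Longrightarrow> d \<in> moves G s \<Longrightarrow> (s, d) \<in> edges G"
  by (simp add: edges_def)

lemma wf_edges: "wf ((edges G)\<inverse>)"
proof (rule finite_acyclic_wf_converse)
  have "edges G \<subseteq> states G \<times> states G" using moves_state by (auto simp: edges_def nonterminals_def)
  then show "finite (edges G)" using fin by (meson finite_SigmaI finite_subset)
  show "acyclic (edges G)" using game by (simp add: game_structure_def)
qed

lemma state_induct [consumes 1, case_names final inner]:
  assumes "s \<in> states G"
    and "\<And>s. s \<in> terminals G \<Longrightarrow> P s"
    and "\<And>s. s \<in> nonterminals G \<Longrightarrow> (\<And>d. d \<in> moves G s \<Longrightarrow> P d) \<Longrightarrow> P s"
  shows "P s"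
  using assms(1)
proof (induction s rule: wf_induct_rule[OF wf_edges])
  case (1 s)
  show ?case
  proof (cases "s \<in> terminals G")
    case False
    then have s: "s \<in> nonterminals G" using 1 nonterm by blast
    show ?thesis using assms(3)[OF s] 1(1) edge[OF s] moves_state[OF s] by auto
  qed (use assms(2) in blast)
qed

lemma two_moves: "s \<in> nonterminals G \<Longrightarrow> \<exists>c1 c2. moves G s = {c1, c2}"
proof -
  assume s: "s \<in> nonterminals G"
  have "finite (moves G s)" using moves_state[OF s] finite_subset[OF _ fin] by blast
  moreover have "moves G s \<noteq> {}" "card (moves G s) \<le> 2"
    using s game bin by (auto simp: game_structure_def binary_def)
  ultimately have "card (moves G s) = 1 \<or> card (moves G s) = 2" using card_gt_0_iff[of "moves G s"] by auto
  then show ?thesis by (auto simp: card_1_singleton_iff card_2_iff)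
qed

text \<open>Counting strictly worse terminals gives equal integers exactly to equal outcomes,
  whatever the utilities are.\<close>

definition rk :: "player \<Rightarrow> 's \<Rightarrow> int" where
  "rk i t = int (card {t' \<in> terminals G. prefers G i t t'})"

lemma rk_less:
  assumes "t' \<in> terminals G" "prefers G i t t'"
  shows "rk i t' < rk i t"
proof -
  have "{t'' \<in> terminals G. prefers G i t' t''} \<subset> {t'' \<in> terminals G. prefers G i t t''}"
    using assms by (auto simp: prefers_def)
  then show ?thesis unfolding rk_def using fin_term by (simp add: psubset_card_mono)
qed

lemma prefers_total: "prefers G i t t' \<or> prefers G i t' t \<or> same_outcome G t t'"
  unfolding prefers_def same_outcome_def by (cases i) (metis other.simps player.exhaust linorder_less_linear)+

lemma same_rk: "same_outcome G t t' \<Longrightarrow> rk i t = rk i t'"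
  by (simp add: rk_def same_outcome_def prefers_def)

lemma rk_eq: "t \<in> terminals G \<Longrightarrow> t' \<in> terminals G \<Longrightarrow> rk i t = rk i t' \<longleftrightarrow> same_outcome G t t'"
  using rk_less prefers_total same_rk by (metis less_irrefl)

lemma prefers_rk: "t \<in> terminals G \<Longrightarrow> t' \<in> terminals G \<Longrightarrow> prefers G i t t' \<longleftrightarrow> rk i t' < rk i t"
  using rk_less prefers_total same_rk by (metis less_asym less_irrefl)

lemma weakly_rk: "t \<in> terminals G \<Longrightarrow> t' \<in> terminals G \<Longrightarrow> weakly_prefers G i t t' \<longleftrightarrow> rk i t' \<le> rk i t"
  unfolding weakly_prefers_def using prefers_rk rk_eq by (metis order_le_less)

definition K :: int where "K = int (card (terminals G))"
definition U :: "int set" where "U = rk P1 ` terminals G"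
text \<open>
  Only the values on \<open>U\<close> and at the two ranks \<open>-1\<close> and \<open>K\<close> of unaffordable bids matter; the
  half-integers are fillers that make the map injective.
\<close>

definition \<phi> :: "int \<Rightarrow> real" where
  "\<phi> n = (if n \<in> U then real_of_int (rk P2 (SOME t. t \<in> terminals G \<and> rk P1 t = n))
          else if n = -1 then real_of_int K else if n = K then -1 else real_of_int n + 1/2)"

lemma rk_bounds: "t \<in> terminals G \<Longrightarrow> 0 \<le> rk i t \<and> rk i t < K"
proof -
  assume t: "t \<in> terminals G"
  have "{t' \<in> terminals G. prefers G i t t'} \<subset> terminals G" using t by (auto simp: prefers_def)
  then show ?thesis unfolding rk_def K_def using fin_term by (simp add: psubset_card_mono)
qed

lemma phi_rk: "t \<in> terminals G \<Longrightarrow> \<phi> (rk P1 t) = real_of_int (rk P2 t)"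
proof -
  assume t: "t \<in> terminals G"
  let ?t = "SOME t'. t' \<in> terminals G \<and> rk P1 t' = rk P1 t"
  have "?t \<in> terminals G \<and> rk P1 ?t = rk P1 t" by (rule someI[of _ t]) (use t in auto)
  then have "rk P2 ?t = rk P2 t" using rk_eq[OF _ t] by blast
  then show ?thesis using t by (auto simp: \<phi>_def U_def)
qed

lemma U_bounds: "u \<in> U \<Longrightarrow> 0 \<le> u \<and> u < K \<and> 0 \<le> \<phi> u \<and> \<phi> u < K"
  using rk_bounds phi_rk by (auto simp: U_def)

lemma phi_ends: "\<phi> (-1) = K" "\<phi> K = -1"
  using U_bounds[of "-1"] U_bounds[of K] by (auto simp: \<phi>_def K_def)

lemma phi_inj: "inj \<phi>"
proof (rule injI)
  fix p q assume e: "\<phi> p = \<phi> q"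
  have half: "real_of_int m \<noteq> real_of_int n + 1/2" for m n :: int
  proof
    assume "real_of_int m = real_of_int n + 1/2"
    then have "real_of_int (2 * m) = real_of_int (2 * n + 1)" by simp
    then have "2 * m = 2 * n + 1" by linarith
    then show False by presburger
  qed
  have cl: "p \<in> U \<or> p = -1 \<or> p = K \<or> (\<phi> p = real_of_int p + 1/2)" for p by (auto simp: \<phi>_def)
  have int: "p \<in> U \<Longrightarrow> \<exists>m. \<phi> p = real_of_int m" for p by (auto simp: \<phi>_def)
  have UU: "p = q" if "p \<in> U" "q \<in> U"
    using that e rk_eq by (auto simp: U_def phi_rk)
  show "p = q"
    using cl[of p] cl[of q]
  proof (elim disjE)
    assume "p \<in> U" "q \<in> U" then show ?thesis by (rule UU)
  next
    assume "p \<in> U" "q = -1" then show ?thesis using U_bounds[of p] phi_ends e by auto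
  next
    assume "p \<in> U" "q = K" then show ?thesis using U_bounds[of p] phi_ends e by auto
  next
    assume "p \<in> U" "\<phi> q = real_of_int q + 1/2" then show ?thesis using int[of p] half e by metis
  next
    assume "p = -1" "q \<in> U" then show ?thesis using U_bounds[of q] phi_ends e by auto
  next
    assume "p = K" "q \<in> U" then show ?thesis using U_bounds[of q] phi_ends e by auto
  next
    assume "\<phi> p = real_of_int p + 1/2" "q \<in> U" then show ?thesis using int[of q] half e by metis
  next
    assume "\<phi> p = real_of_int p + 1/2" "q = -1" then show ?thesis using half phi_ends e by metis
  next
    assume "\<phi> p = real_of_int p + 1/2" "q = K" then show ?thesis using half[of "-1" p] phi_ends e by simp
  next
    assume "p = -1" "\<phi> q = real_of_int q + 1/2" then show ?thesis using half phi_ends e by metis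
  next
    assume "p = K" "\<phi> q = real_of_int q + 1/2" then show ?thesis using half[of "-1" q] phi_ends e by simp
  next
    assume "p = -1" "q = K" then show ?thesis using phi_ends e by (simp add: K_def)
  next
    assume "p = K" "q = -1" then show ?thesis using phi_ends e by (simp add: K_def)
  next
    assume "\<phi> p = real_of_int p + 1/2" "\<phi> q = real_of_int q + 1/2"
    then have "real_of_int p = real_of_int q" using e by linarith
    then show ?thesis by simp
  qed auto
qed

section \<open>Play in units of \<epsilon>\<close>

lemma step_terminal: "t \<in> terminals G \<Longrightarrow> (step G \<gamma> ^^ n) (t, B) = (t, B)"
  by (induction n) auto

lemma outcome_terminal: "t \<in> terminals G \<Longrightarrow> outcome G \<gamma> t B = t"
  unfolding outcome_def by (rule the_equality) (auto simp: step_terminal)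

text \<open>A run from \<open>s\<close> needs at least one round to reach a terminal, so it meets
  the same terminals as the run from the position after that round.\<close>

lemma outcome_step:
  assumes "s \<notin> terminals G"
  shows "outcome G \<gamma> s B = (if wins \<gamma> P1 s B then outcome G \<gamma> (choice \<gamma> P1 s B) (B - bid \<gamma> P1 s B)
     else outcome G \<gamma> (choice \<gamma> P2 s B) (B + bid \<gamma> P2 s B))"
proof -
  obtain s' B' where e: "step G \<gamma> (s, B) = (s', B')" by fastforce
  have "outcome G \<gamma> s B = outcome G \<gamma> s' B'"
  proof -
    have "(t \<in> terminals G \<and> (\<exists>n. fst ((step G \<gamma> ^^ n) (s, B)) = t)) \<longleftrightarrow>
      (t \<in> terminals G \<and> (\<exists>n. fst ((step G \<gamma> ^^ n) (s', B')) = t))" for t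
    proof (intro conj_cong refl iffI)
      assume t: "t \<in> terminals G" "\<exists>n. fst ((step G \<gamma> ^^ n) (s, B)) = t"
      then obtain n where n: "fst ((step G \<gamma> ^^ n) (s, B)) = t" by blast
      then have "n \<noteq> 0" using t assms by (intro notI) auto
      then obtain m where "n = Suc m" using not0_implies_Suc by blast
      then have "fst ((step G \<gamma> ^^ m) (s', B')) = t" using n e by (simp add: funpow_swap1)
      then show "\<exists>n. fst ((step G \<gamma> ^^ n) (s', B')) = t" by blast
    next
      assume "\<exists>n. fst ((step G \<gamma> ^^ n) (s', B')) = t"
      then obtain n where "fst ((step G \<gamma> ^^ n) (s', B')) = t" by blast
      then have "fst ((step G \<gamma> ^^ Suc n) (s, B)) = t" using e by (simp add: funpow_swap1)
      then show "\<exists>n. fst ((step G \<gamma> ^^ n) (s, B)) = t" by blast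
    qed
    then show ?thesis unfolding outcome_def by simp
  qed
  then show ?thesis using e assms by (auto split: if_splits)
qed

definition out :: "'s profile \<Rightarrow> 's \<Rightarrow> int \<Rightarrow> 's" where
  "out \<gamma> s x = outcome G \<gamma> s (real_of_int x * \<epsilon>)"

lemma out_terminal: "t \<in> terminals G \<Longrightarrow> out \<gamma> t x = t"
  by (simp add: out_def outcome_terminal)

definition legal :: "'s profile \<Rightarrow> bool" where
  "legal \<gamma> \<longleftrightarrow> (\<forall>i. legal_strategy G \<epsilon> i (\<gamma> i))"

definition unit_bid :: "'s profile \<Rightarrow> player \<Rightarrow> 's \<Rightarrow> int \<Rightarrow> int" where
  "unit_bid \<gamma> i s x = \<lfloor>bid \<gamma> i s (real_of_int x * \<epsilon>) / \<epsilon>\<rfloor>"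
definition unit_choice :: "'s profile \<Rightarrow> player \<Rightarrow> 's \<Rightarrow> int \<Rightarrow> 's" where
  "unit_choice \<gamma> i s x = choice \<gamma> i s (real_of_int x * \<epsilon>)"

fun units :: "player \<Rightarrow> int \<Rightarrow> int" where
  "units P1 x = x" | "units P2 x = N - x"

lemma budget_units: "budget_of i (real_of_int x * \<epsilon>) = real_of_int (units i x) * \<epsilon>"
  using N_eps by (cases i) (auto simp: algebra_simps)

lemma unit_bidI: "bid \<gamma> i s (real_of_int x * \<epsilon>) = real_of_int b * \<epsilon> \<Longrightarrow> unit_bid \<gamma> i s x = b"
  using eps_pos by (simp add: unit_bid_def)

context
  fixes \<gamma> :: "'s profile" and s :: 's and x :: int
  assumes leg: "legal \<gamma>" and s: "s \<in> nonterminals G" and x: "0 \<le> x" "x \<le> N"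
begin

lemma unit_bid: "bid \<gamma> i s (real_of_int x * \<epsilon>) = real_of_int (unit_bid \<gamma> i s x) * \<epsilon>"
    "0 \<le> unit_bid \<gamma> i s x" "unit_bid \<gamma> i s x \<le> units i x"
proof -
  have B: "bid \<gamma> i s (real_of_int x * \<epsilon>) \<in> budgets \<epsilon>" "bid \<gamma> i s (real_of_int x * \<epsilon>) \<le> budget_of i (real_of_int x * \<epsilon>)"
    using leg s grid[OF x] by (auto simp: legal_def legal_strategy_def bid_def)
  then obtain b where b: "0 \<le> b" "bid \<gamma> i s (real_of_int x * \<epsilon>) = real_of_int b * \<epsilon>" using budgets_iff by blast
  then have u: "unit_bid \<gamma> i s x = b" by (intro unit_bidI)
  show "bid \<gamma> i s (real_of_int x * \<epsilon>) = real_of_int (unit_bid \<gamma> i s x) * \<epsilon>" "0 \<le> unit_bid \<gamma> i s x" using b u by auto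
  show "unit_bid \<gamma> i s x \<le> units i x" using B(2) b(2) u scale_le by (simp add: budget_units)
qed

lemma unit_choice: "unit_choice \<gamma> i s x \<in> moves G s"
  using leg s grid[OF x] by (auto simp: legal_def legal_strategy_def choice_def unit_choice_def)

lemma wins_unit: "wins \<gamma> P1 s (real_of_int x * \<epsilon>) \<longleftrightarrow> unit_bid \<gamma> P2 s x \<le> unit_bid \<gamma> P1 s x"
  by (simp add: wins_def unit_bid scale_le)

lemma out_step:
  "out \<gamma> s x = (if unit_bid \<gamma> P2 s x \<le> unit_bid \<gamma> P1 s x
     then out \<gamma> (unit_choice \<gamma> P1 s x) (x - unit_bid \<gamma> P1 s x)
     else out \<gamma> (unit_choice \<gamma> P2 s x) (x + unit_bid \<gamma> P2 s x))"
proof -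
  have "s \<notin> terminals G" using s nonterm by blast
  then show ?thesis
    unfolding out_def outcome_step[OF \<open>s \<notin> terminals G\<close>] wins_unit unit_choice_def unit_bid(1) by (simp add: algebra_simps)
qed

lemma unit_range:
  "0 \<le> x - unit_bid \<gamma> P1 s x" "x - unit_bid \<gamma> P1 s x \<le> N" "0 \<le> x + unit_bid \<gamma> P2 s x" "x + unit_bid \<gamma> P2 s x \<le> N"
  using unit_bid(2,3)[of P1] unit_bid(2,3)[of P2] x by auto

end

lemma out_in_terminals:
  assumes "s \<in> states G" "legal \<gamma>" "0 \<le> x" "x \<le> N"
  shows "out \<gamma> s x \<in> terminals G"
  using assms(1,3,4)
proof (induction s arbitrary: x rule: state_induct)
  case (inner s)
  note L = assms(2) inner(1) inner(3,4)
  show ?case unfolding out_step[OF L] using inner(2) unit_choice[OF L] unit_range[OF L] by simp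
qed (simp add: out_terminal)

lemma out_cong:
  assumes "s \<in> states G" "legal \<gamma>" "legal \<gamma>'" "0 \<le> x" "x \<le> N"
    and "\<And>s' B i. s' \<in> nonterminals G \<Longrightarrow> (s, s') \<in> (edges G)\<^sup>* \<Longrightarrow> \<gamma> i s' B = \<gamma>' i s' B"
  shows "out \<gamma> s x = out \<gamma>' s x"
  using assms(1,4-)
proof (induction s arbitrary: x rule: state_induct)
  case (inner s)
  note L = assms(2) inner(1) inner(3,4)
  note L' = assms(3) inner(1) inner(3,4)
  have e: "unit_bid \<gamma>' i s x = unit_bid \<gamma> i s x" "unit_choice \<gamma>' i s x = unit_choice \<gamma> i s x" for i
    using inner(5)[OF inner(1)] by (auto simp: unit_bid_def bid_def unit_choice_def choice_def)
  have IH: "out \<gamma> d y = out \<gamma>' d y" if "d \<in> moves G s" "0 \<le> y" "y \<le> N" for d y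
    using inner(2)[OF that] inner(5) edge[OF inner(1) that(1)] by (meson converse_rtrancl_into_rtrancl)
  show ?case unfolding out_step[OF L] out_step[OF L'] e using IH unit_choice[OF L] unit_range[OF L] by simp
qed (simp add: out_terminal)

section \<open>Equilibria and one-shot deviations\<close>

definition val :: "'s profile \<Rightarrow> 's \<Rightarrow> int \<Rightarrow> int" where
  "val \<gamma> s x = (if x < 0 then -1 else if N < x then K else rk P1 (out \<gamma> s x))"

lemma val_in: "0 \<le> x \<Longrightarrow> x \<le> N \<Longrightarrow> val \<gamma> s x = rk P1 (out \<gamma> s x)"
  by (simp add: val_def)

definition result :: "('s \<Rightarrow> int \<Rightarrow> int) \<Rightarrow> int \<Rightarrow> int \<Rightarrow> 's \<Rightarrow> int \<Rightarrow> 's \<Rightarrow> int" where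
  "result v x b1 d1 b2 d2 = (if b2 \<le> b1 then v d1 (x - b1) else v d2 (x + b2))"

lemma val_step:
  assumes "legal \<gamma>" "s \<in> nonterminals G" "0 \<le> x" "x \<le> N"
  shows "val \<gamma> s x = result (val \<gamma>) x (unit_bid \<gamma> P1 s x) (unit_choice \<gamma> P1 s x) (unit_bid \<gamma> P2 s x) (unit_choice \<gamma> P2 s x)"
  using out_step[OF assms] unit_range[OF assms] assms by (simp add: val_in result_def)

definition local_nash :: "('s \<Rightarrow> int \<Rightarrow> int) \<Rightarrow> 's \<Rightarrow> int \<Rightarrow> int \<Rightarrow> 's \<Rightarrow> int \<Rightarrow> 's \<Rightarrow> bool" where
  "local_nash v s x b1 d1 b2 d2 \<longleftrightarrow>
     (\<forall>b d. 0 \<le> b \<longrightarrow> b \<le> x \<longrightarrow> d \<in> moves G s \<longrightarrow> result v x b d b2 d2 \<le> result v x b1 d1 b2 d2) \<and>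
     (\<forall>b d. 0 \<le> b \<longrightarrow> b \<le> N - x \<longrightarrow> d \<in> moves G s \<longrightarrow> \<phi> (result v x b1 d1 b d) \<le> \<phi> (result v x b1 d1 b2 d2))"

definition profile_nash :: "'s profile \<Rightarrow> bool" where
  "profile_nash \<gamma> \<longleftrightarrow> (\<forall>s\<in>nonterminals G. \<forall>x\<in>{0..N}.
     local_nash (val \<gamma>) s x (unit_bid \<gamma> P1 s x) (unit_choice \<gamma> P1 s x) (unit_bid \<gamma> P2 s x) (unit_choice \<gamma> P2 s x))"

lemma rk_P2: "t \<in> terminals G \<Longrightarrow> real_of_int (rk P2 t) = \<phi> (rk P1 t)"
  by (simp add: phi_rk)

lemma PSPE_legal: "PSPE G \<epsilon> \<gamma> \<Longrightarrow> legal \<gamma>"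
  by (simp add: PSPE_def legal_def)

lemma legal_update: "legal \<gamma> \<Longrightarrow> legal_strategy G \<epsilon> i \<sigma> \<Longrightarrow> legal (\<gamma>(i := \<sigma>))"
  by (simp add: legal_def)

lemma PSPE_rk:
  assumes "PSPE G \<epsilon> \<gamma>" "s \<in> states G" "0 \<le> x" "x \<le> N" "legal_strategy G \<epsilon> i \<sigma>"
  shows "rk i (out (\<gamma>(i := \<sigma>)) s x) \<le> rk i (out \<gamma> s x)"
proof -
  have "weakly_prefers G i (out \<gamma> s x) (out (\<gamma>(i := \<sigma>)) s x)"
    using assms grid[of x] unfolding PSPE_def out_def by blast
  then show ?thesis
    using weakly_rk out_in_terminals assms PSPE_legal legal_update by blast
qed

text \<open>The deviation touches one state at one budget. Acyclicity keeps that state from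
  recurring, so the outcomes at the successors are unchanged.\<close>

lemma one_shot:
  assumes P: "PSPE G \<epsilon> \<gamma>" and s: "s \<in> nonterminals G" and x: "0 \<le> x" "x \<le> N"
    and b: "0 \<le> b" "b \<le> units i x" and d: "d \<in> moves G s"
  obtains \<gamma>' where "legal \<gamma>'" "rk i (out \<gamma>' s x) \<le> rk i (out \<gamma> s x)" "unit_bid \<gamma>' i s x = b" "unit_choice \<gamma>' i s x = d"
    "unit_bid \<gamma>' (other i) s x = unit_bid \<gamma> (other i) s x" "unit_choice \<gamma>' (other i) s x = unit_choice \<gamma> (other i) s x"
    "\<And>c y. c \<in> moves G s \<Longrightarrow> 0 \<le> y \<Longrightarrow> y \<le> N \<Longrightarrow> out \<gamma>' c y = out \<gamma> c y"
proof -
  let ?B = "real_of_int x * \<epsilon>"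
  define \<sigma> where "\<sigma> = (\<gamma> i)(s := (\<gamma> i s)(?B := (real_of_int b * \<epsilon>, d)))"
  define \<gamma>' where "\<gamma>' = \<gamma>(i := \<sigma>)"
  have units: "units i x \<le> N" using x by (cases i) auto
  have leg: "legal \<gamma>" using PSPE_legal[OF P] .
  have l\<sigma>: "legal_strategy G \<epsilon> i \<sigma>"
    using leg b d grid[of b] units scale_le[of b "units i x"] unfolding legal_def legal_strategy_def \<sigma>_def by (auto simp: budget_units)
  have leg': "legal \<gamma>'" unfolding \<gamma>'_def using legal_update[OF leg l\<sigma>] .
  have same: "out \<gamma>' c y = out \<gamma> c y" if c: "c \<in> moves G s" and y: "0 \<le> y" "y \<le> N" for c y
  proof (rule out_cong[OF moves_state[OF s c] leg' leg y])
    fix s' B j assume r: "(c, s') \<in> (edges G)\<^sup>*"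
    have "s' \<noteq> s"
    proof
      assume "s' = s"
      then have "(s, s) \<in> (edges G)\<^sup>+" using r edge[OF s c] by (simp add: rtrancl_into_trancl2)
      then show False using game by (auto simp: game_structure_def acyclic_def)
    qed
    then show "\<gamma>' j s' B = \<gamma> j s' B" by (simp add: \<gamma>'_def \<sigma>_def)
  qed
  have oi: "other i \<noteq> i" by (cases i) auto
  show thesis
  proof (rule that[OF leg' _ _ _ _ _ same])
    show "rk i (out \<gamma>' s x) \<le> rk i (out \<gamma> s x)" unfolding \<gamma>'_def using PSPE_rk[OF P _ x l\<sigma>] s nonterm by blast
    show "unit_bid \<gamma>' i s x = b" by (rule unit_bidI) (simp add: bid_def \<gamma>'_def \<sigma>_def)
    show "unit_choice \<gamma>' i s x = d" by (simp add: unit_choice_def choice_def \<gamma>'_def \<sigma>_def)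
    show "unit_bid \<gamma>' (other i) s x = unit_bid \<gamma> (other i) s x" "unit_choice \<gamma>' (other i) s x = unit_choice \<gamma> (other i) s x"
      using oi by (simp_all add: unit_bid_def bid_def unit_choice_def choice_def \<gamma>'_def)
  qed
qed

lemma PSPE_imp_nash:
  assumes P: "PSPE G \<epsilon> \<gamma>" shows "profile_nash \<gamma>"
  unfolding profile_nash_def local_nash_def
proof (intro ballI conjI allI impI)
  fix s x b d
  assume s: "s \<in> nonterminals G" and x: "x \<in> {0..N}" and b: "0 \<le> b" "b \<le> x" and d: "d \<in> moves G s"
  have x: "0 \<le> x" "x \<le> N" using x by auto
  have leg: "legal \<gamma>" using PSPE_legal[OF P] .
  obtain \<gamma>' where g: "legal \<gamma>'" "rk P1 (out \<gamma>' s x) \<le> rk P1 (out \<gamma> s x)" "unit_bid \<gamma>' P1 s x = b" "unit_choice \<gamma>' P1 s x = d"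
    "unit_bid \<gamma>' P2 s x = unit_bid \<gamma> P2 s x" "unit_choice \<gamma>' P2 s x = unit_choice \<gamma> P2 s x"
    "\<And>c y. c \<in> moves G s \<Longrightarrow> 0 \<le> y \<Longrightarrow> y \<le> N \<Longrightarrow> out \<gamma>' c y = out \<gamma> c y"
    using one_shot[OF P s x b(1), of P1 d] b(2) d by auto
  have "val \<gamma>' s x \<le> val \<gamma> s x" using g(2) x by (simp add: val_in)
  moreover have "val \<gamma>' s x = result (val \<gamma>) x b d (unit_bid \<gamma> P2 s x) (unit_choice \<gamma> P2 s x)"
    unfolding val_step[OF g(1) s x] g(3-6) result_def
    using g(7) d unit_choice[OF leg s x] unit_range[OF leg s x] b x by (simp add: val_in)
  ultimately show "result (val \<gamma>) x b d (unit_bid \<gamma> P2 s x) (unit_choice \<gamma> P2 s x)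
      \<le> result (val \<gamma>) x (unit_bid \<gamma> P1 s x) (unit_choice \<gamma> P1 s x) (unit_bid \<gamma> P2 s x) (unit_choice \<gamma> P2 s x)"
    using val_step[OF leg s x] by simp
next
  fix s x b d
  assume s: "s \<in> nonterminals G" and x: "x \<in> {0..N}" and b: "0 \<le> b" "b \<le> N - x" and d: "d \<in> moves G s"
  have x: "0 \<le> x" "x \<le> N" using x by auto
  have leg: "legal \<gamma>" using PSPE_legal[OF P] .
  obtain \<gamma>' where g: "legal \<gamma>'" "rk P2 (out \<gamma>' s x) \<le> rk P2 (out \<gamma> s x)" "unit_bid \<gamma>' P2 s x = b" "unit_choice \<gamma>' P2 s x = d"
    "unit_bid \<gamma>' P1 s x = unit_bid \<gamma> P1 s x" "unit_choice \<gamma>' P1 s x = unit_choice \<gamma> P1 s x"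
    "\<And>c y. c \<in> moves G s \<Longrightarrow> 0 \<le> y \<Longrightarrow> y \<le> N \<Longrightarrow> out \<gamma>' c y = out \<gamma> c y"
    using one_shot[OF P s x b(1), of P2 d] b(2) d by auto
  have ss: "s \<in> states G" using s nonterm by blast
  have "real_of_int (rk P2 (out \<gamma>' s x)) \<le> real_of_int (rk P2 (out \<gamma> s x))" using g(2) by simp
  then have "\<phi> (val \<gamma>' s x) \<le> \<phi> (val \<gamma> s x)"
    unfolding rk_P2[OF out_in_terminals[OF ss g(1) x]] rk_P2[OF out_in_terminals[OF ss leg x]] using x by (simp add: val_in)
  moreover have "val \<gamma>' s x = result (val \<gamma>) x (unit_bid \<gamma> P1 s x) (unit_choice \<gamma> P1 s x) b d"
    unfolding val_step[OF g(1) s x] g(3-6) result_def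
    using g(7) d unit_choice[OF leg s x] unit_range[OF leg s x] b x by (simp add: val_in)
  ultimately show "\<phi> (result (val \<gamma>) x (unit_bid \<gamma> P1 s x) (unit_choice \<gamma> P1 s x) b d)
      \<le> \<phi> (result (val \<gamma>) x (unit_bid \<gamma> P1 s x) (unit_choice \<gamma> P1 s x) (unit_bid \<gamma> P2 s x) (unit_choice \<gamma> P2 s x))"
    using val_step[OF leg s x] by simp
qed

text \<open>One-shot deviation principle: by induction a deviation gains nothing after the present
  round, and local optimality covers the present one.\<close>

lemma nash_imp_PSPE:
  assumes leg: "legal \<gamma>" and nash: "profile_nash \<gamma>" shows "PSPE G \<epsilon> \<gamma>"
proof -
  have dev1: "val (\<gamma>(P1 := \<sigma>)) s x \<le> val \<gamma> s x" if "s \<in> states G" "legal_strategy G \<epsilon> P1 \<sigma>" "0 \<le> x" "x \<le> N" for s x \<sigma>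
    using that(1,3,4)
  proof (induction s arbitrary: x rule: state_induct)
    case (inner s)
    define g where g: "g = \<gamma>(P1 := \<sigma>)"
    note IH = inner(2)[folded g]
    note L = legal_update[OF leg that(2), folded g] inner(1,3,4) note L0 = leg inner(1,3,4)
    have e: "unit_bid g P2 s x = unit_bid \<gamma> P2 s x" "unit_choice g P2 s x = unit_choice \<gamma> P2 s x"
      by (simp_all add: g unit_bid_def bid_def unit_choice_def choice_def)
    have "val g s x \<le> result (val \<gamma>) x (unit_bid g P1 s x) (unit_choice g P1 s x) (unit_bid \<gamma> P2 s x) (unit_choice \<gamma> P2 s x)"
      unfolding val_step[OF L] e result_def using IH unit_choice[OF L] unit_range[OF L] unit_choice[OF L0] unit_range[OF L0] by auto
    also have "\<dots> \<le> val \<gamma> s x" unfolding val_step[OF L0]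
      using nash inner(1,3,4) unit_bid(2,3)[OF L, of P1] unit_choice[OF L, of P1] unfolding profile_nash_def local_nash_def by simp
    finally show ?case unfolding g .
  qed (simp add: val_def out_terminal)
  have dev2: "\<phi> (val (\<gamma>(P2 := \<sigma>)) s x) \<le> \<phi> (val \<gamma> s x)" if "s \<in> states G" "legal_strategy G \<epsilon> P2 \<sigma>" "0 \<le> x" "x \<le> N" for s x \<sigma>
    using that(1,3,4)
  proof (induction s arbitrary: x rule: state_induct)
    case (inner s)
    define g where g: "g = \<gamma>(P2 := \<sigma>)"
    note IH = inner(2)[folded g]
    note L = legal_update[OF leg that(2), folded g] inner(1,3,4) note L0 = leg inner(1,3,4)
    have e: "unit_bid g P1 s x = unit_bid \<gamma> P1 s x" "unit_choice g P1 s x = unit_choice \<gamma> P1 s x"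
      by (simp_all add: g unit_bid_def bid_def unit_choice_def choice_def)
    have "\<phi> (val g s x) \<le> \<phi> (result (val \<gamma>) x (unit_bid \<gamma> P1 s x) (unit_choice \<gamma> P1 s x) (unit_bid g P2 s x) (unit_choice g P2 s x))"
      unfolding val_step[OF L] e result_def using IH unit_choice[OF L] unit_range[OF L] unit_choice[OF L0] unit_range[OF L0] by auto
    also have "\<dots> \<le> \<phi> (val \<gamma> s x)" unfolding val_step[OF L0]
      using nash inner(1,3,4) unit_bid(2,3)[OF L, of P2] unit_choice[OF L, of P2] unfolding profile_nash_def local_nash_def by simp
    finally show ?case unfolding g .
  qed (simp add: val_def out_terminal)
  have "weakly_prefers G i (out \<gamma> s x) (out (\<gamma>(i := \<sigma>)) s x)" if "s \<in> states G" "0 \<le> x" "x \<le> N" "legal_strategy G \<epsilon> i \<sigma>" for s x i \<sigma>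
  proof -
    have T: "out \<gamma> s x \<in> terminals G" "out (\<gamma>(i := \<sigma>)) s x \<in> terminals G"
      using out_in_terminals that leg legal_update by blast+
    have "rk i (out (\<gamma>(i := \<sigma>)) s x) \<le> rk i (out \<gamma> s x)"
    proof (cases i)
      case P1 then show ?thesis using dev1[of s \<sigma> x] that by (simp add: val_in)
    next
      case P2
      then have "\<phi> (rk P1 (out (\<gamma>(i := \<sigma>)) s x)) \<le> \<phi> (rk P1 (out \<gamma> s x))" using dev2[of s \<sigma> x] that by (simp add: val_in)
      then show ?thesis unfolding phi_rk[OF T(1)] phi_rk[OF T(2)] using P2 by simp
    qed
    then show ?thesis using weakly_rk[OF T] by simp
  qed
  then have "weakly_prefers G i (outcome G \<gamma> s B) (outcome G (\<gamma>(i := \<sigma>)) s B)"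
    if "s \<in> states G" "B \<in> budgets \<epsilon>" "legal_strategy G \<epsilon> i \<sigma>" for s B i \<sigma>
    using that budgets_iff[of B] unfolding out_def by auto
  then show ?thesis using leg unfolding PSPE_def legal_def by blast
qed

end

sublocale bidding_game \<subseteq> ranked_outcomes \<phi> K N U
proof
  show "U \<subseteq> {0..<K}" "0 \<le> K" using U_bounds by (auto simp: K_def)
qed (use phi_inj N_pos phi_ends U_bounds in auto)

context bidding_game begin

section \<open>Backward induction\<close>

definition walk_lengths :: "'s \<Rightarrow> nat set" where
  "walk_lengths s = {n. \<exists>t\<in>terminals G. (s, t) \<in> edges G ^^ n}"

lemma walk_lengths_step:
  assumes "s \<in> nonterminals G"
  shows "walk_lengths s = (\<Union>d\<in>moves G s. Suc ` walk_lengths d)"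
proof -
  have "n \<in> walk_lengths s \<longleftrightarrow> (\<exists>d\<in>moves G s. n \<in> Suc ` walk_lengths d)" for n
  proof (cases n)
    case 0
    then show ?thesis using assms nonterm by (auto simp: walk_lengths_def)
  next
    case (Suc m)
    have "(s, t) \<in> edges G ^^ Suc m \<longleftrightarrow> (\<exists>d\<in>moves G s. (d, t) \<in> edges G ^^ m)" for t
    proof
      assume "(s, t) \<in> edges G ^^ Suc m"
      then obtain d where "(s, d) \<in> edges G" "(d, t) \<in> edges G ^^ m" by (rule relpow_Suc_E2)
      then show "\<exists>d\<in>moves G s. (d, t) \<in> edges G ^^ m" by (auto simp: edges_def)
    qed (use edge[OF assms] relpow_Suc_I2 in \<open>metis\<close>)
    then show ?thesis using Suc by (auto simp: walk_lengths_def)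
  qed
  then show ?thesis by blast
qed

lemma walk_lengths:
  assumes "s \<in> states G" shows "finite (walk_lengths s) \<and> walk_lengths s \<noteq> {}"
  using assms
proof (induction s rule: state_induct)
  case (final s)
  have "walk_lengths s \<subseteq> {0}"
  proof
    fix n assume "n \<in> walk_lengths s"
    then obtain t where "(s, t) \<in> edges G ^^ n" by (auto simp: walk_lengths_def)
    moreover have "(s, d) \<notin> edges G" for d using final nonterm by (auto simp: edges_def)
    ultimately show "n \<in> {0}" by (cases n) (auto elim: relpow_Suc_E2 simp del: relpow.simps(2))
  qed
  moreover have "0 \<in> walk_lengths s" using final by (auto simp: walk_lengths_def)
  ultimately show ?case using finite_subset by blast
next
  case (inner s)
  then show ?case using two_moves[OF inner(1)] unfolding walk_lengths_step[OF inner(1)] by auto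
qed

abbreviation ht :: "'s \<Rightarrow> nat" where "ht s \<equiv> state_height G s"

lemma ht_def: "ht s = Max (walk_lengths s)"
  by (simp add: state_height_def walk_lengths_def)

lemma ht_less: "s \<in> nonterminals G \<Longrightarrow> d \<in> moves G s \<Longrightarrow> ht d < ht s"
proof -
  assume s: "s \<in> nonterminals G" and d: "d \<in> moves G s"
  have "ht d \<in> walk_lengths d" unfolding ht_def using walk_lengths[OF moves_state[OF s d]] Max_in by blast
  then have "Suc (ht d) \<in> walk_lengths s" unfolding walk_lengths_step[OF s] using d by blast
  then show ?thesis unfolding ht_def[of s] using walk_lengths[of s] s nonterm Max_ge[of "walk_lengths s"] by (metis Suc_le_lessD ht_def)
qed

text \<open>Every state is reachable from the initial one, and heights fall along edges.\<close>

lemma ht_le: "s \<in> states G \<Longrightarrow> ht s \<le> k"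
proof -
  assume "s \<in> states G"
  from reach[OF this] show ?thesis
  proof (induction rule: rtrancl_induct)
    case base
    then show ?case using hk by (simp add: height_def)
  next
    case (step y z)
    then have "ht z < ht y" by (intro ht_less) (auto simp: edges_def)
    then show ?case using step by simp
  qed
qed

definition ends :: "'s \<Rightarrow> 's set" where
  "ends s = {t \<in> terminals G. (s, t) \<in> (edges G)\<^sup>*}"

lemma ends_terminal: "s \<in> terminals G \<Longrightarrow> ends s = {s}"
proof -
  assume s: "s \<in> terminals G"
  have "t = s" if "(s, t) \<in> (edges G)\<^sup>*" for t
    using that by (cases rule: converse_rtranclE) (use s nonterm in \<open>auto simp: edges_def\<close>)
  then show ?thesis using s by (auto simp: ends_def)
qed

lemma ends_step: "s \<in> nonterminals G \<Longrightarrow> ends s = (\<Union>d\<in>moves G s. ends d)"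
proof -
  assume s: "s \<in> nonterminals G"
  have "(s, t) \<in> (edges G)\<^sup>* \<longleftrightarrow> (\<exists>d\<in>moves G s. (d, t) \<in> (edges G)\<^sup>*)" if "t \<in> terminals G" for t
  proof
    assume "(s, t) \<in> (edges G)\<^sup>*"
    then show "\<exists>d\<in>moves G s. (d, t) \<in> (edges G)\<^sup>*"
      by (cases rule: converse_rtranclE) (use s that nonterm in \<open>auto simp: edges_def\<close>)
  qed (use edge[OF s] in \<open>meson converse_rtrancl_into_rtrancl\<close>)
  then show ?thesis by (auto simp: ends_def)
qed

text \<open>If there is a single move, the two kids coincide, so forced moves need no separate
  treatment.\<close>

definition kids :: "'s \<Rightarrow> 's \<times> 's" where
  "kids s = (SOME p. moves G s = {fst p, snd p})"
abbreviation "kid1 s \<equiv> fst (kids s)"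
abbreviation "kid2 s \<equiv> snd (kids s)"

lemma kids: "s \<in> nonterminals G \<Longrightarrow> moves G s = {kid1 s, kid2 s}"
proof -
  assume "s \<in> nonterminals G"
  then obtain c1 c2 where "moves G s = {c1, c2}" using two_moves by blast
  then have "moves G s = {fst (c1, c2), snd (c1, c2)}" by simp
  then show ?thesis unfolding kids_def by (rule someI)
qed

definition canon :: "('s \<Rightarrow> int \<Rightarrow> int) \<Rightarrow> 's \<Rightarrow> int \<Rightarrow> int \<Rightarrow> 's \<Rightarrow> int \<Rightarrow> 's \<Rightarrow> bool" where
  "canon v s x b1 d1 b2 d2 \<longleftrightarrow> d1 \<in> moves G s \<and> d2 \<in> moves G s \<and>
     two_chains.canonical \<phi> (v (kid1 s)) (v (kid2 s)) x b1 (v d1) b2 (v d2)"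

definition act :: "('s \<Rightarrow> int \<Rightarrow> int) \<Rightarrow> 's \<Rightarrow> int \<Rightarrow> int \<times> 's \<times> int \<times> 's" where
  "act v s x = (SOME (b1, d1, b2, d2). canon v s x b1 d1 b2 d2)"

definition backward :: "('s \<Rightarrow> int \<Rightarrow> int) \<Rightarrow> 's \<Rightarrow> int \<Rightarrow> int" where
  "backward v s x = (if s \<in> terminals G then leaf (rk P1 s) x else if x < 0 then -1 else if N < x then K
     else case act v s x of (b1, d1, b2, d2) \<Rightarrow> result v x b1 d1 b2 d2)"

text \<open>
  Recursion on the values of states, not on profiles, so that only the immediate successors of a
  state are accessed.
\<close>

definition V :: "'s \<Rightarrow> int \<Rightarrow> int" where
  "V = wfrec ((edges G)\<inverse>) backward"

lemma V_terminal: "s \<in> terminals G \<Longrightarrow> V s = leaf (rk P1 s)"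
  unfolding V_def by (subst wfrec[OF wf_edges]) (simp add: backward_def fun_eq_iff)

lemma canon_cong:
  assumes "s \<in> nonterminals G" "\<And>d. d \<in> moves G s \<Longrightarrow> v d = v' d"
  shows "canon v s = canon v' s"
proof -
  have "v (kid1 s) = v' (kid1 s)" "v (kid2 s) = v' (kid2 s)" using kids[OF assms(1)] assms(2) by auto
  note e = this
  have "canon v s x b1 d1 b2 d2 = canon v' s x b1 d1 b2 d2" for x b1 d1 b2 d2
    unfolding canon_def e using assms(2) by auto
  then show ?thesis by (intro ext)
qed

lemma V_outside: "s \<in> nonterminals G \<Longrightarrow> x < 0 \<Longrightarrow> V s x = -1" "s \<in> nonterminals G \<Longrightarrow> N < x \<Longrightarrow> V s x = K"
  unfolding V_def by (subst wfrec[OF wf_edges], use nonterm N_pos in \<open>simp add: backward_def\<close>)+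

lemma V_inner:
  assumes s: "s \<in> nonterminals G" and x: "0 \<le> x" "x \<le> N" and tc: "two_chains \<phi> N (V (kid1 s)) (V (kid2 s))"
  obtains b1 d1 b2 d2 where "act V s x = (b1, d1, b2, d2)" "canon V s x b1 d1 b2 d2" "V s x = result V x b1 d1 b2 d2"
proof -
  \<comment> \<open>Well-founded recursion passes this truncation of \<open>V\<close> to
    \<open>backward\<close>; it agrees with \<open>V\<close> on the successors, which is all that
    \<open>canon\<close> inspects.\<close>
  define v where "v = cut V ((edges G)\<inverse>) s"
  have v: "v d = V d" if "d \<in> moves G s" for d using edge[OF s that] by (simp add: v_def cut_apply)
  have can: "canon v s = canon V s" using canon_cong[OF s] v by blast
  then have act: "act v s x = act V s x" by (simp add: act_def)
  obtain b1 f1 b2 f2 where c: "two_chains.canonical \<phi> (V (kid1 s)) (V (kid2 s)) x b1 f1 b2 f2"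
    using two_chains.canonical_exists[OF tc] by blast
  then have "f1 \<in> {V (kid1 s), V (kid2 s)}" "f2 \<in> {V (kid1 s), V (kid2 s)}" using two_chains.canonicalD(3,4)[OF tc] by blast+
  then obtain d1 d2 where "d1 \<in> moves G s" "d2 \<in> moves G s" "f1 = V d1" "f2 = V d2" using kids[OF s] by auto
  then have "canon V s x b1 d1 b2 d2" using c by (simp add: canon_def)
  then have ex: "(\<lambda>(b1, d1, b2, d2). canon V s x b1 d1 b2 d2) (b1, d1, b2, d2)" by simp
  obtain b1 d1 b2 d2 where a: "act V s x = (b1, d1, b2, d2)" by (metis prod_cases4)
  then have cV: "canon V s x b1 d1 b2 d2"
    using someI[where P="\<lambda>(b1, d1, b2, d2). canon V s x b1 d1 b2 d2", OF ex] unfolding act_def by simp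
  have "V s x = backward v s x" unfolding V_def v_def by (subst wfrec[OF wf_edges]) simp
  also have "\<dots> = result v x b1 d1 b2 d2" using x s nonterm a act by (simp add: backward_def)
  also have "\<dots> = result V x b1 d1 b2 d2" using v cV by (simp add: result_def canon_def)
  finally show thesis using that a cV by blast
qed

text \<open>The cell length at height \<open>ht s\<close>: all of \<open>N\<close> at terminals,
  halved with each level, and \<open>R\<close> at height \<open>k\<close>.\<close>

definition grain :: "'s \<Rightarrow> int" where "grain s = int R * 2 ^ (k - ht s)"

lemma result_stage: "two_chains \<phi> N a c \<Longrightarrow> result v x b1 d1 b2 d2 = two_chains.stage x b1 (v d1) b2 (v d2)"
  by (simp add: result_def two_chains.stage_def)

lemma V_good: "s \<in> states G \<Longrightarrow> good (grain s) (rk P1 ` ends s) (V s)"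
proof (induction s rule: state_induct)
  case (final s)
  then show ?case using leaf_good[of "rk P1 s"] by (simp add: V_terminal ends_terminal U_def)
next
  case (inner s)
  let ?a = "V (kid1 s)" and ?c = "V (kid2 s)" and ?L = "2 * grain s"
  have kd: "kid1 s \<in> moves G s" "kid2 s \<in> moves G s" using kids[OF inner(1)] by auto
  have h: "ht s \<le> k" using ht_le inner(1) nonterm by blast
  have d: "?L dvd grain d" if "d \<in> moves G s" for d
  proof -
    \<comment> \<open>A successor may be several levels lower; its grid is then coarser than
      required, which \<open>good_dvd\<close> absorbs.\<close>
    have "k - ht s + 1 \<le> k - ht d" using ht_less[OF inner(1) that] h by simp
    then have "(2::int) ^ (k - ht s + 1) dvd 2 ^ (k - ht d)" by (rule le_imp_power_dvd)
    then show ?thesis by (simp add: grain_def)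
  qed
  have "?L dvd N"
  proof -
    have "k - ht s + 1 \<le> k" using ht_less[OF inner(1) kd(1)] h by simp
    then have "(2::int) ^ (k - ht s + 1) dvd 2 ^ k" by (rule le_imp_power_dvd)
    then show ?thesis by (simp add: grain_def N_def)
  qed
  have g: "good ?L (rk P1 ` ends (kid1 s)) ?a" "good ?L (rk P1 ` ends (kid2 s)) ?c"
    using inner(2)[OF kd(1)] inner(2)[OF kd(2)] d[OF kd(1)] d[OF kd(2)] good_dvd by blast+
  then have tc: "two_chains \<phi> N ?a ?c" using two_chainsI by (auto simp: good_def)
  interpret two_chains \<phi> N ?a ?c by (rule tc)
  have m: "merged \<phi> ?a ?c (2*x+1) (V s x) \<and> (\<exists>y\<in>{0..N}. V s x = ?a y \<or> V s x = ?c y)" if x: "0 \<le> x" "x \<le> N" for x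
  proof -
    obtain b1 d1 b2 d2 where "act V s x = (b1, d1, b2, d2)" and r: "canon V s x b1 d1 b2 d2" "V s x = result V x b1 d1 b2 d2"
      by (rule V_inner[OF inner(1) x tc])
    have can: "canonical x b1 (V d1) b2 (V d2)" using r(1) by (simp add: canon_def)
    have "merged \<phi> ?a ?c (2*x+1) (V s x)" unfolding r(2) result_stage[OF tc] using canonical_merged[OF x can] .
    moreover have "x - b1 \<in> {0..N}" "x + b2 \<in> {0..N}" using canonical_bounds[OF x can] x by auto
    then have "\<exists>y\<in>{0..N}. V s x = ?a y \<or> V s x = ?c y"
      using canonicalD(3,4)[OF can] unfolding r(2) result_def by auto
    ultimately show ?thesis by blast
  qed
  have "0 < grain s" using R by (simp add: grain_def)
  then have "good (grain s) (rk P1 ` ends (kid1 s) \<union> rk P1 ` ends (kid2 s)) (V s)"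
    using merge_good[OF refl \<open>?L dvd N\<close> _ g, of "V s"] V_outside[OF inner(1)] m by blast
  then show ?case using kids[OF inner(1)] by (simp add: ends_step[OF inner(1)] image_Un)
qed

lemma V_chain: "s \<in> states G \<Longrightarrow> chain (V s)"
  using V_good[of s] by (simp add: good_def)

lemma V_kids: "s \<in> nonterminals G \<Longrightarrow> two_chains \<phi> N (V (kid1 s)) (V (kid2 s))"
proof -
  assume s: "s \<in> nonterminals G"
  then have "kid1 s \<in> states G" "kid2 s \<in> states G" using kids[OF s] moves_state[OF s] by auto
  then have "chain (V (kid1 s))" "chain (V (kid2 s))" using V_chain by auto
  then show ?thesis by (rule two_chainsI)
qed

section \<open>The auction profile is a subgame perfect equilibrium\<close>

definition bottom_profile :: "'s profile" where
  "bottom_profile i s B = (case act V s \<lfloor>B / \<epsilon>\<rfloor> of (b1, d1, b2, d2) \<Rightarrow>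
     (case i of P1 \<Rightarrow> (real_of_int b1 * \<epsilon>, d1) | P2 \<Rightarrow> (real_of_int b2 * \<epsilon>, d2)))"

lemma bottom_profile_canon:
  assumes s: "s \<in> nonterminals G" and x: "0 \<le> x" "x \<le> N"
  shows "canon V s x (unit_bid bottom_profile P1 s x) (unit_choice bottom_profile P1 s x) (unit_bid bottom_profile P2 s x) (unit_choice bottom_profile P2 s x)"
    "V s x = result V x (unit_bid bottom_profile P1 s x) (unit_choice bottom_profile P1 s x) (unit_bid bottom_profile P2 s x) (unit_choice bottom_profile P2 s x)"
    "bid bottom_profile i s (real_of_int x * \<epsilon>) = real_of_int (unit_bid bottom_profile i s x) * \<epsilon>"
proof -
  obtain b1 d1 b2 d2 where a: "act V s x = (b1, d1, b2, d2)" and r: "canon V s x b1 d1 b2 d2" "V s x = result V x b1 d1 b2 d2"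
    by (rule V_inner[OF s x V_kids[OF s]])
  have st: "bottom_profile P1 s (real_of_int x * \<epsilon>) = (real_of_int b1 * \<epsilon>, d1)" "bottom_profile P2 s (real_of_int x * \<epsilon>) = (real_of_int b2 * \<epsilon>, d2)"
    using a eps_pos by (simp_all add: bottom_profile_def)
  then have u: "unit_bid bottom_profile P1 s x = b1" "unit_bid bottom_profile P2 s x = b2" "unit_choice bottom_profile P1 s x = d1" "unit_choice bottom_profile P2 s x = d2"
    by (auto intro!: unit_bidI simp: bid_def unit_choice_def choice_def)
  show "canon V s x (unit_bid bottom_profile P1 s x) (unit_choice bottom_profile P1 s x) (unit_bid bottom_profile P2 s x) (unit_choice bottom_profile P2 s x)"
    "V s x = result V x (unit_bid bottom_profile P1 s x) (unit_choice bottom_profile P1 s x) (unit_bid bottom_profile P2 s x) (unit_choice bottom_profile P2 s x)"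
    unfolding u using r by auto
  show "bid bottom_profile i s (real_of_int x * \<epsilon>) = real_of_int (unit_bid bottom_profile i s x) * \<epsilon>"
    using st u by (cases i) (simp_all add: bid_def)
qed

lemma canon_canonical: "canon v s x b1 d1 b2 d2 \<Longrightarrow> two_chains.canonical \<phi> (v (kid1 s)) (v (kid2 s)) x b1 (v d1) b2 (v d2)"
  by (simp add: canon_def)

lemma bottom_profile_bounds:
  assumes s: "s \<in> nonterminals G" and x: "0 \<le> x" "x \<le> N"
  shows "0 \<le> unit_bid bottom_profile i s x" "unit_bid bottom_profile i s x \<le> units i x" "unit_choice bottom_profile i s x \<in> moves G s"
  using two_chains.canonical_bounds[OF V_kids[OF s] x canon_canonical[OF bottom_profile_canon(1)[OF s x]]]
    bottom_profile_canon(1)[OF s x] by (cases i; simp add: canon_def)+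

lemma bottom_profile_legal: "legal bottom_profile"
  unfolding legal_def legal_strategy_def
proof (intro allI ballI)
  fix i s B assume s: "s \<in> nonterminals G" and "B \<in> budgets \<epsilon>"
  then obtain x where x: "0 \<le> x" "x \<le> N" "B = real_of_int x * \<epsilon>" using budgets_iff by blast
  have u: "units i x \<le> N" using x by (cases i) auto
  have "fst (bottom_profile i s B) = real_of_int (unit_bid bottom_profile i s x) * \<epsilon>"
    using bottom_profile_canon(3)[OF s x(1,2)] x(3) by (simp add: bid_def)
  moreover have "snd (bottom_profile i s B) \<in> moves G s" using bottom_profile_bounds(3)[OF s x(1,2), of i] x(3) by (simp add: unit_choice_def choice_def)
  ultimately show "fst (bottom_profile i s B) \<in> budgets \<epsilon> \<and> fst (bottom_profile i s B) \<le> budget_of i B \<and> snd (bottom_profile i s B) \<in> moves G s"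
    using bottom_profile_bounds(1,2)[OF s x(1,2), of i] u grid[of "unit_bid bottom_profile i s x"] x(3) by (auto simp: budget_units scale_le)
qed

lemma val_outside: "x < 0 \<Longrightarrow> val \<gamma> s x = -1" "N < x \<Longrightarrow> val \<gamma> s x = K"
  using N_pos by (auto simp: val_def)

lemma V_outside': "s \<in> states G \<Longrightarrow> x < 0 \<Longrightarrow> V s x = -1" "s \<in> states G \<Longrightarrow> N < x \<Longrightarrow> V s x = K"
  using chainD(1,2)[OF V_chain] by auto

lemma val_eqI:
  assumes "s \<in> states G" "\<And>x. 0 \<le> x \<Longrightarrow> x \<le> N \<Longrightarrow> val \<gamma> s x = V s x"
  shows "val \<gamma> s = V s"
proof
  fix x show "val \<gamma> s x = V s x"
    using assms(2)[of x] val_outside[of x \<gamma> s] V_outside'[OF assms(1), of x] by (cases "x < 0"; cases "N < x") auto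
qed

lemma val_terminal: "s \<in> terminals G \<Longrightarrow> val \<gamma> s = V s"
  by (rule ext) (simp add: val_def V_terminal leaf_def out_terminal)

lemma bottom_profile_val: "s \<in> states G \<Longrightarrow> val bottom_profile s = V s"
proof (induction s rule: state_induct)
  case (inner s)
  have "val bottom_profile s x = V s x" if x: "0 \<le> x" "x \<le> N" for x
    unfolding val_step[OF bottom_profile_legal inner(1) x] bottom_profile_canon(2)[OF inner(1) x] result_def
    using inner(2) bottom_profile_bounds(3)[OF inner(1) x] by simp
  then show ?case using inner(1) nonterm val_eqI by blast
qed (rule val_terminal)

lemma local_nash_iff:
  assumes s: "s \<in> nonterminals G" and tc: "two_chains \<phi> N (v (kid1 s)) (v (kid2 s))"
    and b: "0 \<le> b1" "b1 \<le> x" "0 \<le> b2" "b2 \<le> N - x" and d: "d1 \<in> moves G s" "d2 \<in> moves G s"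
  shows "local_nash v s x b1 d1 b2 d2 \<longleftrightarrow> two_chains.nash \<phi> N (v (kid1 s)) (v (kid2 s)) x b1 (v d1) b2 (v d2)"
proof -
  have m: "(\<forall>b f. 0 \<le> b \<longrightarrow> b \<le> y \<longrightarrow> f \<in> {v (kid1 s), v (kid2 s)} \<longrightarrow> P b f) \<longleftrightarrow>
      (\<forall>b d. 0 \<le> b \<longrightarrow> b \<le> y \<longrightarrow> d \<in> moves G s \<longrightarrow> P b (v d))" for P and y :: int
    using kids[OF s] by auto
  have f: "v d1 \<in> {v (kid1 s), v (kid2 s)}" "v d2 \<in> {v (kid1 s), v (kid2 s)}" using d kids[OF s] by auto
  show ?thesis
    unfolding local_nash_def two_chains.nash_def[OF tc] result_stage[OF tc] m by (simp only: b f simp_thms)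
qed

lemma bottom_profile_PSPE: "PSPE G \<epsilon> bottom_profile"
proof (rule nash_imp_PSPE[OF bottom_profile_legal], unfold profile_nash_def, intro ballI)
  fix s x assume s: "s \<in> nonterminals G" and "x \<in> {0..N}"
  then have x: "0 \<le> x" "x \<le> N" by auto
  note tc = V_kids[OF s]
  have e: "val bottom_profile d = V d" if "d \<in> moves G s" for d using bottom_profile_val moves_state[OF s that] .
  have k: "kid1 s \<in> moves G s" "kid2 s \<in> moves G s" using kids[OF s] by auto
  note b = bottom_profile_bounds(1,2)[OF s x, of P1] bottom_profile_bounds(1,2)[OF s x, of P2]
  note d = bottom_profile_bounds(3)[OF s x]
  show "local_nash (val bottom_profile) s x (unit_bid bottom_profile P1 s x) (unit_choice bottom_profile P1 s x) (unit_bid bottom_profile P2 s x) (unit_choice bottom_profile P2 s x)"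
    using two_chains.canonical_nash[OF tc x canon_canonical[OF bottom_profile_canon(1)[OF s x]]]
      local_nash_iff[OF s, of "val bottom_profile", unfolded e[OF k(1)] e[OF k(2)], OF tc] b d e[OF d] by simp
qed

section \<open>Comparison in the order on profiles\<close>

lemma bids_gt_irrefl: "\<not> bids_gt p p"
  by (cases p) auto

lemma gt_not_eq: "subgame_gt G \<epsilon> \<gamma>' \<gamma> s \<Longrightarrow> \<not> subgame_eq G \<epsilon> \<gamma>' \<gamma> s"
proof (induction rule: subgame_gt.induct)
  case (1 s)
  show ?case
  proof
    assume eq: "subgame_eq G \<epsilon> \<gamma>' \<gamma> s"
    then have "subgame_eq G \<epsilon> \<gamma>' \<gamma> d" if "d \<in> moves G s" for d
      using edge[OF 1(1) that] unfolding subgame_eq_def by (meson converse_rtrancl_into_rtrancl)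
    moreover have "\<not> state_gt \<epsilon> \<gamma>' \<gamma> s" using eq 1(1) bids_gt_irrefl by (auto simp: subgame_eq_def state_gt_def)
    ultimately show False using 1 by blast
  qed
qed

text \<open>Both relations at a state entail comparability at each of its successors, so the
  comparison descends along paths from the initial state.\<close>

lemma ge_everywhere:
  assumes "profile_ge G \<epsilon> \<gamma>' \<gamma>" "s \<in> states G"
  shows "subgame_gt G \<epsilon> \<gamma>' \<gamma> s \<or> subgame_eq G \<epsilon> \<gamma>' \<gamma> s"
  using reach[OF assms(2)]
proof (induction rule: rtrancl_induct)
  case base
  then show ?case using assms(1) by (simp add: profile_ge_def)
next
  case (step y z)
  have z: "z \<in> moves G y" using step(2) by (simp add: edges_def)
  from step(3) show ?case
  proof
    assume "subgame_gt G \<epsilon> \<gamma>' \<gamma> y" then show ?thesis by cases (use z in blast)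
  next
    assume "subgame_eq G \<epsilon> \<gamma>' \<gamma> y"
    then show ?thesis using step(2) unfolding subgame_eq_def by (meson converse_rtrancl_into_rtrancl)
  qed
qed

text \<open>A successor has height below \<open>k\<close>, so its grain keeps a factor 2 and its
  steps lie at even budgets or at \<open>N + 1\<close>; \<open>N\<close> itself is no
  boundary.\<close>

lemma kids_separate:
  assumes s: "s \<in> nonterminals G"
  shows "\<not> (two_chains.cross (V (kid1 s)) (V (kid2 s)) y \<and> two_chains.cross (V (kid1 s)) (V (kid2 s)) (y+1))"
proof
  assume c: "two_chains.cross (V (kid1 s)) (V (kid2 s)) y \<and> two_chains.cross (V (kid1 s)) (V (kid2 s)) (y+1)"
  have "boundary 2 z" if cz: "two_chains.cross (V (kid1 s)) (V (kid2 s)) z" for z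
  proof -
    obtain d where d: "d \<in> moves G s" "V d (z-1) \<noteq> V d z"
      using cz kids[OF s] unfolding two_chains.cross_def[OF V_kids[OF s]] by auto
    have h: "ht d < k" using ht_less[OF s d(1)] ht_le[of s] s nonterm by force
    then have "2 dvd grain d" by (simp add: grain_def)
    then have "good 2 (rk P1 ` ends d) (V d)" using V_good[OF moves_state[OF s d(1)]] good_dvd by blast
    then show ?thesis using d(2) by (simp add: good_def)
  qed
  then have "boundary 2 y" "boundary 2 (y+1)" using c by auto
  then show False unfolding boundary_def by presburger
qed

lemma bids_unit:
  assumes "legal \<gamma>" "s \<in> nonterminals G" "0 \<le> x" "x \<le> N"
  shows "bids \<gamma> s (real_of_int x * \<epsilon>) = (real_of_int (unit_bid \<gamma> P1 s x) * \<epsilon>, real_of_int (unit_bid \<gamma> P2 s x) * \<epsilon>)"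
  using unit_bid(1)[OF assms] by (simp add: bids_def)

lemma scale_less: "real_of_int x * \<epsilon> < real_of_int y * \<epsilon> \<longleftrightarrow> x < y"
  using eps_pos by simp

lemma scale_max: "max (real_of_int x * \<epsilon>) (real_of_int y * \<epsilon>) = real_of_int (max x y) * \<epsilon>"
  and scale_min: "min (real_of_int x * \<epsilon>) (real_of_int y * \<epsilon>) = real_of_int (min x y) * \<epsilon>"
  using scale_le by (auto simp: max_def min_def)

lemma lower_not_gt:
  assumes "two_chains \<phi> N a c" "two_chains.lower b1 b2 b1' b2'"
  shows "\<not> bids_gt (real_of_int b1 * \<epsilon>, real_of_int b2 * \<epsilon>) (real_of_int b1' * \<epsilon>, real_of_int b2' * \<epsilon>)"
proof -
  have "\<not> (max b1' b2' < max b1 b2 \<or> max b1 b2 = max b1' b2' \<and> min b1 b2 < min b1' b2' \<or> b1 = b2' \<and> b1' < b2' \<and> b1' = b2)"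
    using assms(2) unfolding two_chains.lower_def[OF assms(1)] by auto
  then show ?thesis unfolding bids_gt.simps scale_max scale_min scale_less scale_eq .
qed

section \<open>The bottom equilibrium\<close>

context
  fixes \<gamma> :: "'s profile"
  assumes BE: "bottom_equilibrium G \<epsilon> \<gamma>"
begin

lemma BE_PSPE: "PSPE G \<epsilon> \<gamma>"
  using BE by (simp add: bottom_equilibrium_def)

lemma BE_nash_kids:
  assumes s: "s \<in> nonterminals G" and x: "0 \<le> x" "x \<le> N" and e: "\<And>d. d \<in> moves G s \<Longrightarrow> val \<gamma> d = V d"
  shows "two_chains.nash \<phi> N (V (kid1 s)) (V (kid2 s)) x (unit_bid \<gamma> P1 s x) (V (unit_choice \<gamma> P1 s x))
      (unit_bid \<gamma> P2 s x) (V (unit_choice \<gamma> P2 s x))"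
proof -
  note L = PSPE_legal[OF BE_PSPE] s x
  have k: "kid1 s \<in> moves G s" "kid2 s \<in> moves G s" using kids[OF s] by auto
  have "local_nash (val \<gamma>) s x (unit_bid \<gamma> P1 s x) (unit_choice \<gamma> P1 s x) (unit_bid \<gamma> P2 s x) (unit_choice \<gamma> P2 s x)"
    using PSPE_imp_nash[OF BE_PSPE] s x by (simp add: profile_nash_def)
  then show ?thesis
    using local_nash_iff[OF s, of "val \<gamma>", unfolded e[OF k(1)] e[OF k(2)], OF V_kids[OF s]]
     unit_bid(2,3)[OF L, of P1] unit_bid(2,3)[OF L, of P2] unit_choice[OF L] e by simp
qed

text \<open>With the successors settled by induction, only the bids at \<open>s\<close> can differ.
  Minimality of \<gamma> puts the auction profile weakly above it, while
  \<open>nash_above_canonical\<close> denies that it is strictly above. Equal bids then give equal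
  values by \<open>nash_stage\<close>.\<close>

lemma BE_eq_bottom_profile: "s \<in> states G \<Longrightarrow> subgame_eq G \<epsilon> bottom_profile \<gamma> s \<and> val \<gamma> s = V s"
proof (induction s rule: state_induct)
  case (final s)
  have "(s, s') \<in> (edges G)\<^sup>* \<Longrightarrow> s' = s" for s'
    by (erule converse_rtranclE) (use final nonterm in \<open>auto simp: edges_def\<close>)
  then show ?case using final val_terminal nonterm by (auto simp: subgame_eq_def)
next
  case (inner s)
  note s = inner(1)
  note tc = V_kids[OF s]
  have leg: "legal \<gamma>" using PSPE_legal[OF BE_PSPE] .
  have ss: "s \<in> states G" using s nonterm by blast
  have "profile_ge G \<epsilon> bottom_profile \<gamma>" using BE bottom_profile_PSPE by (simp add: bottom_equilibrium_def)
  from ge_everywhere[OF this ss] have ge: "subgame_gt G \<epsilon> bottom_profile \<gamma> s \<or> subgame_eq G \<epsilon> bottom_profile \<gamma> s" .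
  have nash: "two_chains.nash \<phi> N (V (kid1 s)) (V (kid2 s)) x (unit_bid \<gamma> P1 s x) (V (unit_choice \<gamma> P1 s x))
      (unit_bid \<gamma> P2 s x) (V (unit_choice \<gamma> P2 s x))" if "0 \<le> x" "x \<le> N" for x
    using BE_nash_kids[OF s that] inner(2) by blast
  have "\<not> state_gt \<epsilon> bottom_profile \<gamma> s"
  proof
    assume "state_gt \<epsilon> bottom_profile \<gamma> s"
    then obtain B where B: "B \<in> budgets \<epsilon>" "bids_gt (bids bottom_profile s B) (bids \<gamma> s B)" by (auto simp: state_gt_def)
    then obtain x where x: "0 \<le> x" "x \<le> N" "B = real_of_int x * \<epsilon>" using budgets_iff by blast
    have "two_chains.lower (unit_bid bottom_profile P1 s x) (unit_bid bottom_profile P2 s x) (unit_bid \<gamma> P1 s x) (unit_bid \<gamma> P2 s x)"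
      using two_chains.nash_above_canonical[OF tc x(1,2) canon_canonical[OF bottom_profile_canon(1)[OF s x(1,2)]] nash[OF x(1,2)] kids_separate[OF s]] .
    from lower_not_gt[OF tc this] show False
      using B(2) unfolding x(3) bids_unit[OF bottom_profile_legal s x(1,2)] bids_unit[OF leg s x(1,2)] by blast
  qed
  then have "\<not> subgame_gt G \<epsilon> bottom_profile \<gamma> s"
    using inner(2) gt_not_eq by (metis subgame_gt.cases)
  then have eq: "subgame_eq G \<epsilon> bottom_profile \<gamma> s" using ge by blast
  have "val \<gamma> s x = V s x" if x: "0 \<le> x" "x \<le> N" for x
  proof -
    have "bids bottom_profile s (real_of_int x * \<epsilon>) = bids \<gamma> s (real_of_int x * \<epsilon>)"
      using eq s grid[OF x] by (auto simp: subgame_eq_def)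
    then have b: "unit_bid bottom_profile i s x = unit_bid \<gamma> i s x" for i
      unfolding bids_unit[OF bottom_profile_legal s x] bids_unit[OF leg s x] using scale_eq by (cases i) auto
    have "V s x = two_chains.stage x (unit_bid bottom_profile P1 s x) (V (unit_choice bottom_profile P1 s x)) (unit_bid bottom_profile P2 s x) (V (unit_choice bottom_profile P2 s x))"
      using bottom_profile_canon(2)[OF s x] result_stage[OF tc] by simp
    also have "\<dots> = two_chains.stage x (unit_bid \<gamma> P1 s x) (V (unit_choice \<gamma> P1 s x)) (unit_bid \<gamma> P2 s x) (V (unit_choice \<gamma> P2 s x))"
      using two_chains.nash_stage[OF tc x nash[OF x]]
        two_chains.nash_stage[OF tc x two_chains.canonical_nash[OF tc x canon_canonical[OF bottom_profile_canon(1)[OF s x]]]]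
      unfolding b by simp
    also have "\<dots> = result V x (unit_bid \<gamma> P1 s x) (unit_choice \<gamma> P1 s x) (unit_bid \<gamma> P2 s x) (unit_choice \<gamma> P2 s x)"
      using result_stage[OF tc] by simp
    also have "\<dots> = val \<gamma> s x"
      unfolding val_step[OF leg s x] result_def using inner(2) unit_choice[OF leg s x] by simp
    finally show ?thesis by simp
  qed
  then show ?case using eq val_eqI[OF ss] by blast
qed

section \<open>The asserted properties of the bottom equilibrium\<close>

lemma BE_bids:
  assumes s: "s \<in> nonterminals G" and B: "B \<in> budgets \<epsilon>"
  shows "(wins \<gamma> P1 s B \<longrightarrow> bid \<gamma> P1 s B = bid \<gamma> P2 s B) \<and> (wins \<gamma> P2 s B \<longrightarrow> bid \<gamma> P2 s B = bid \<gamma> P1 s B + \<epsilon>)"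
proof -
  obtain x where x: "0 \<le> x" "x \<le> N" "B = real_of_int x * \<epsilon>" using B budgets_iff by blast
  have "bids bottom_profile s B = bids \<gamma> s B" using BE_eq_bottom_profile[of s] s nonterm B by (auto simp: subgame_eq_def)
  then have b: "bid \<gamma> i s B = real_of_int (unit_bid bottom_profile i s x) * \<epsilon>" for i
    using bottom_profile_canon(3)[OF s x(1,2)] x(3) by (cases i) (auto simp: bids_def)
  have "unit_bid bottom_profile P1 s x = unit_bid bottom_profile P2 s x \<or> unit_bid bottom_profile P2 s x = unit_bid bottom_profile P1 s x + 1"
    using two_chains.canonical_cases[OF V_kids[OF s] x(1,2) canon_canonical[OF bottom_profile_canon(1)[OF s x(1,2)]]] by metis
  then show ?thesis unfolding wins_def b using eps_pos by (auto simp: algebra_simps)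
qed

lemma BE_rk:
  assumes "s \<in> states G" "0 \<le> x" "x \<le> N"
  shows "rk P1 (outcome G \<gamma> s (real_of_int x * \<epsilon>)) = V s x" "outcome G \<gamma> s (real_of_int x * \<epsilon>) \<in> terminals G"
  using BE_eq_bottom_profile[OF assms(1)] val_in[OF assms(2,3), of \<gamma> s] out_in_terminals[OF assms(1) PSPE_legal[OF BE_PSPE] assms(2,3)]
  by (simp_all add: out_def)

text \<open>Each grain is a multiple of \<open>R\<close>, the length of a cell in units of
  \<epsilon>, so no value changes strictly inside a cell.\<close>

lemma BE_interval: "interval_profile G \<epsilon> k \<gamma>"
  unfolding interval_profile_def
proof (intro ballI allI impI)
  fix s j B assume s: "s \<in> nonterminals G" and j: "j < 2 ^ k" and B: "B \<in> budget_interval \<epsilon> k j"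
  have ss: "s \<in> states G" using s nonterm by blast
  let ?y = "int R * int j"
  have y: "real j / 2 ^ k = real_of_int ?y * \<epsilon>" using R by (simp add: eps)
  have y1: "real (j + 1) / 2 ^ k = real_of_int (?y + int R) * \<epsilon>" using R by (simp add: eps field_simps)
  obtain x where x: "0 \<le> x" "x \<le> N" "B = real_of_int x * \<epsilon>" using B budgets_iff by (auto simp: budget_interval_def)
  have yN: "?y + int R \<le> N"
  proof -
    have "int (j + 1) \<le> 2 ^ k" using j by (metis Suc_eq_plus1 Suc_leI of_nat_le_iff of_nat_numeral of_nat_power)
    then have "int R * int (j + 1) \<le> int R * 2 ^ k" by (intro mult_left_mono) auto
    then show ?thesis by (simp add: N_def algebra_simps)
  qed
  have range: "?y \<le> x \<and> (x < ?y + int R \<or> x = N \<and> ?y + int R = N)"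
  proof (cases "j + 1 = 2 ^ k \<and> B = 1")
    case True
    \<comment> \<open>The closed end of the last cell: \<open>x = N\<close> is the one budget at
      distance \<open>R\<close> from the start of its cell.\<close>
    then have "x = N" using x(3) N_eps scale_eq by metis
    moreover have "int (j + 1) = 2 ^ k" using True by (metis of_nat_numeral of_nat_power)
    then have "?y + int R = N" by (simp add: N_def flip: \<open>int (j + 1) = 2 ^ k\<close>) (simp add: algebra_simps)
    ultimately show ?thesis using R by simp
  next
    case False
    then have "real j / 2 ^ k \<le> B" "B < real (j + 1) / 2 ^ k" using B unfolding budget_interval_def by auto
    then show ?thesis unfolding y y1 x(3) scale_le scale_less by simp
  qed
  have nb: "\<not> boundary (grain s) z" if "?y < z" "z \<le> x" for z
  proof
    assume "boundary (grain s) z"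
    then have z: "grain s dvd z" "z < N" using that x(2) by (auto simp: boundary_def)
    then have "int R dvd z" by (auto simp: grain_def intro: dvd_trans)
    then obtain q where q: "z = int R * q" by blast
    have "int R * int j < int R * q" using that(1) q by simp
    then have "int j < q" using R by simp
    moreover have "z < ?y + int R" using that(2) range z(2) by linarith
    then have "int R * q < int R * (int j + 1)" using q by (simp add: algebra_simps)
    then have "q < int j + 1" using R by (simp only: mult_less_cancel_left_pos of_nat_0_less_iff)
    ultimately show False by simp
  qed
  have "V s (?y + int n) = V s ?y" if "?y + int n \<le> x" for n
    using that
  proof (induction n)
    case (Suc n)
    have "\<not> boundary (grain s) (?y + int (Suc n))" using nb Suc.prems by auto
    then have "V s (?y + int (Suc n) - 1) = V s (?y + int (Suc n))" using V_good[OF ss] unfolding good_def by blast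
    then show ?case using Suc by simp
  qed simp
  from this[of "nat (x - ?y)"] have "V s x = V s ?y" using range by auto
  moreover have "0 \<le> ?y" "?y \<le> N" using yN by auto
  ultimately show "same_outcome G (outcome G \<gamma> s B) (outcome G \<gamma> s (real j / 2 ^ k))"
    unfolding y x(3) using BE_rk[OF ss x(1,2)] BE_rk[OF ss \<open>0 \<le> ?y\<close> \<open>?y \<le> N\<close>] rk_eq by metis
qed

text \<open>Reachability of all terminals turns efficiency within the subgame into efficiency in the
  whole game.\<close>

lemma init_good: "good (grain (init G)) U (V (init G))"
proof -
  have "ends (init G) = terminals G" using reach term_sub by (auto simp: ends_def)
  then show ?thesis using V_good[OF init_state] by (simp add: U_def)
qed

lemma pareto_iff: "t \<in> pareto_terminals G \<longleftrightarrow> t \<in> terminals G \<and> (\<forall>u\<in>U. \<not> (rk P1 t < u \<and> \<phi> (rk P1 t) < \<phi> u))"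
  unfolding pareto_terminals_def using prefers_rk phi_rk by (auto simp: U_def)

lemma BE_pareto_optimal: "pareto_optimal G \<epsilon> \<gamma>"
  unfolding pareto_optimal_def
proof
  fix B assume "B \<in> budgets \<epsilon>"
  then obtain x where x: "0 \<le> x" "x \<le> N" "B = real_of_int x * \<epsilon>" using budgets_iff by blast
  have "\<forall>u\<in>U. \<not> (V (init G) x < u \<and> \<phi> (V (init G) x) < \<phi> u)" using init_good x unfolding good_def by auto
  then show "outcome G \<gamma> (init G) B \<in> pareto_terminals G"
    unfolding pareto_iff x(3) using BE_rk[OF init_state x(1,2)] by simp
qed

lemma BE_pareto_surjective: "pareto_surjective G \<epsilon> \<gamma>"
  unfolding pareto_surjective_def
proof
  fix t assume t: "t \<in> pareto_terminals G"
  then have T: "t \<in> terminals G" "rk P1 t \<in> U" by (auto simp: pareto_terminals_def U_def)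
  obtain x where x: "x \<in> {0..N}" "rk P1 t \<le> V (init G) x" "\<phi> (rk P1 t) \<le> \<phi> (V (init G) x)"
    using init_good T(2) unfolding good_def by blast
  have "V (init G) x \<in> U" using init_good x(1) unfolding good_def by blast
  then have "\<not> (rk P1 t < V (init G) x \<and> \<phi> (rk P1 t) < \<phi> (V (init G) x))" using t by (simp add: pareto_iff)
  \<comment> \<open>Weak domination of an efficient outcome must be an equality for one player, and
    injectivity of \<phi> makes it one for both.\<close>
  then have "rk P1 t = V (init G) x" using x phi_inj by (metis injD order_le_less)
  then have "same_outcome G (outcome G \<gamma> (init G) (real_of_int x * \<epsilon>)) t"
    using BE_rk[OF init_state, of x] x(1) rk_eq T(1) by (metis atLeastAtMost_iff)
  then show "\<exists>B\<in>budgets \<epsilon>. same_outcome G (outcome G \<gamma> (init G) B) t" using grid[of x] x(1) by auto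
qed

lemma BE_monotone: "monotone_profile G \<epsilon> \<gamma>"
  unfolding monotone_profile_def
proof (intro allI ballI impI)
  fix i B B' assume B: "B \<in> budgets \<epsilon>" "B' \<in> budgets \<epsilon>" "budget_of i B < budget_of i B'"
  obtain x where x: "0 \<le> x" "x \<le> N" "B = real_of_int x * \<epsilon>" using B budgets_iff by blast
  obtain x' where x': "0 \<le> x'" "x' \<le> N" "B' = real_of_int x' * \<epsilon>" using B budgets_iff by blast
  note r = BE_rk[OF init_state x(1,2)] BE_rk[OF init_state x'(1,2)]
  have c: "chain (V (init G))" using V_chain[OF init_state] .
  have "rk i (outcome G \<gamma> (init G) B) \<le> rk i (outcome G \<gamma> (init G) B')"
  proof (cases i)
    case P1
    then have "x \<le> x'" using B(3) x(3) x'(3) scale_less by simp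
    then show ?thesis using chainD(4)[OF c] r P1 x(3) x'(3) by simp
  next
    case P2
    then have "x' \<le> x" using B(3) x(3) x'(3) scale_less by simp
    then have "\<phi> (V (init G) x) \<le> \<phi> (V (init G) x')" using chainD(5)[OF c] by simp
    then show ?thesis using r P2 x(3) x'(3) phi_rk[OF r(2)] phi_rk[OF r(4)] by simp
  qed
  then show "weakly_prefers G i (outcome G \<gamma> (init G) B') (outcome G \<gamma> (init G) B)"
    using weakly_rk r x(3) x'(3) by simp
qed

end
end

theorem theorem7:
  fixes G :: "'s game" and \<gamma> :: "'s profile" and \<epsilon> :: real and k R :: nat
  assumes "game_structure G"
    and "binary G"
    and "height G = k"
    and "R \<ge> 4" and "even R"
    and "\<epsilon> = 1 / (real R * 2 ^ k)"
    and "bottom_equilibrium G \<epsilon> \<gamma>"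
  shows "(\<forall>s\<in>nonterminals G. \<forall>B\<in>budgets \<epsilon>.
            (wins \<gamma> P1 s B \<longrightarrow> bid \<gamma> P1 s B = bid \<gamma> P2 s B) \<and>
            (wins \<gamma> P2 s B \<longrightarrow> bid \<gamma> P2 s B = bid \<gamma> P1 s B + \<epsilon>)) \<and>
         interval_profile G \<epsilon> k \<gamma> \<and>
         pareto_surjective G \<epsilon> \<gamma> \<and>
         pareto_optimal G \<epsilon> \<gamma> \<and>
         monotone_profile G \<epsilon> \<gamma>"
proof -
  interpret bidding_game G \<epsilon> R k
    using assms by unfold_locales auto
  show ?thesis
    using BE_bids BE_interval BE_pareto_surjective BE_pareto_optimal BE_monotone assms(7) by blast
qed

end
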